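(* Let $n\ge 1$, let $K\subset\mathbb{R}^n$ be a convex body whose centroid is the origin, and let $\Lambda\subset\mathbb{R}^n$ be an $n$-dimensional lattice. Then $$\frac{n+1}{n!}\prod_{i=1}^n\frac{1}{\rho_i(K,\Lambda)}\le\frac{\mathrm{vol}(K)}{\det(\Lambda)},$$ and the inequality is best possible (i.e., for every $n$ the constant $\frac{n+1}{n!}$ cannot be replaced by a larger one).
   Context: A convex body in $\mathbb{R}^n$ is a compact convex set with non-empty interior; $\mathrm{vol}$ is $n$-dimensional Lebesgue measure. The centroid of $K$ is $\frac{1}{\mathrm{vol}(K)}\int_K \mathbf{x}\,d\mathbf{x}$ (a convex body with centroid $\mathbf{0}$ contains $\mathbf{0}$ in its interior). An $n$-dimensional lattice $\Lambda$ is a discrete subgroup of $\mathbb{R}^n$ spanning $\mathbb{R}^n$; $\det(\Lambda)$ is the volume of a fundamental cell. Packing minima: for a convex body $K\subset\mathbb{R}^n$ with $\mathbf{0}\in\mathrm{int}(K)$, an $n$-dimensional lattice $\Lambda\subset\mathbb{R}^n$ and $1\le i\le n$, $$\rho_i(K,\Lambda)=\inf\{\rho>0:(\rho K+L)\cap\Lambda\ne L\cap\Lambda\ \text{ for all } L\in\mathcal{G}(\mathbb{R}^n,n-i)\},$$ where $\mathcal{G}(\mathbb{R}^n,k)$ is the set of all $k$-dimensional linear subspaces of $\mathbb{R}^n$. *)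

theory Defs
  imports "HOL-Analysis.Analysis"
begin

definition convex_body :: "(real ^ 'n) set \<Rightarrow> bool" where
  "convex_body K \<longleftrightarrow> compact K \<and> convex K \<and> interior K \<noteq> {}"

definition centroid :: "(real ^ 'n) set \<Rightarrow> real ^ 'n" where
  "centroid K = (1 / measure lebesgue K) *\<^sub>R (LINT x:K|lebesgue. x)"

definition full_lattice :: "(real ^ 'n) set \<Rightarrow> bool" where
  "full_lattice \<Lambda> \<longleftrightarrow>
     0 \<in> \<Lambda> \<and> (\<forall>x\<in>\<Lambda>. \<forall>y\<in>\<Lambda>. x - y \<in> \<Lambda>) \<and> discrete \<Lambda> \<and> span \<Lambda> = UNIV"

definition lattice_basis :: "(real ^ 'n) set \<Rightarrow> ('n \<Rightarrow> real ^ 'n) \<Rightarrow> bool" where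
  "lattice_basis \<Lambda> b \<longleftrightarrow> inj b \<and> independent (range b) \<and>
     \<Lambda> = {(\<Sum>j\<in>UNIV. of_int (z j) *\<^sub>R b j) | z :: 'n \<Rightarrow> int. True}"

definition fundamental_cell :: "('n \<Rightarrow> real ^ 'n) \<Rightarrow> (real ^ 'n) set" where
  "fundamental_cell b =
     {(\<Sum>j\<in>UNIV. t j *\<^sub>R b j) | t :: 'n \<Rightarrow> real. \<forall>j. 0 \<le> t j \<and> t j < 1}"

text \<open>
  Every full lattice has a basis, and two bases differ by a unimodular integer matrix, so the
  value below does not depend on the basis chosen by \<open>SOME\<close>.
\<close>

definition lattice_det :: "(real ^ 'n) set \<Rightarrow> real" where
  "lattice_det \<Lambda> = measure lebesgue (fundamental_cell (SOME b. lattice_basis \<Lambda> b))"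

definition grassmannian :: "nat \<Rightarrow> (real ^ 'n) set set" where
  "grassmannian k = {L. subspace L \<and> dim L = k}"

text \<open>
  The sum of sets is the Minkowski sum. For \<open>1 \<le> i \<le> CARD('n)\<close> the subtraction
  \<open>CARD('n) - i\<close> is not truncated. If moreover \<open>0 \<in> interior K\<close> and \<open>\<Lambda>\<close> is a
  full lattice, the set is nonempty, so \<open>Inf\<close> is the true infimum.
\<close>

definition packing_minimum :: "nat \<Rightarrow> (real ^ 'n) set \<Rightarrow> (real ^ 'n) set \<Rightarrow> real" where
  "packing_minimum i K \<Lambda> =
     Inf {\<rho>. 0 < \<rho> \<and>
       (\<forall>L \<in> grassmannian (CARD('n) - i). ((*\<^sub>R) \<rho> ` K + L) \<inter> \<Lambda> \<noteq> L \<inter> \<Lambda>)}"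

end

theory Submission
  imports Defs
begin

text \<open>
  Lower bound. Given admissible radii \<open>r\<^sub>i\<close> for \<open>\<rho>\<^sub>i\<close>, choose lattice vectors \<open>z\<^sub>0, z\<^sub>1, \<dots>\<close> greedily: the
  defining property of \<open>\<rho>\<^sub>n\<^sub>-\<^sub>k\<close>, applied to the span of \<open>z\<^sub>0, \<dots>, z\<^sub>k\<^sub>-\<^sub>1\<close>, yields a lattice vector \<open>z\<^sub>k\<close>
  outside that span which agrees modulo the span with a point \<open>r\<^sub>n\<^sub>-\<^sub>k y\<^sub>k\<close>, \<open>y\<^sub>k \<in> K\<close>. By
  triangularity the determinant of the \<open>y\<^sub>k\<close> is at least \<open>det \<Lambda> / \<Prod>r\<^sub>i\<close>, and \<open>K\<close> contains the
  simplex \<open>T\<close> spanned by 0 and the \<open>y\<^sub>k\<close>. So it remains to show \<open>vol K \<ge> (n + 1) vol T\<close> for a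
  convex body with centroid 0.

  Let \<open>h\<close> be the affine function that is 1 at 0 and 0 at all \<open>y\<^sub>k\<close>; its integral over \<open>K\<close> is
  \<open>vol K\<close>. With \<open>V = vol (K \<inter> {h \<ge> 0})\<close> and \<open>\<tau> = vol T\<close>, the volumes \<open>\<Phi> s = vol (K \<inter> {h \<ge> s})\<close>
  satisfy \<open>\<Phi> s \<le> V - \<tau> (1 - (1 - s)\<^sup>n)\<close> for small \<open>s\<close>, because \<open>T\<close> is lost at this rate. The
  Brunn-Minkowski inequality makes the \<open>n\<close>-th root of \<open>\<Phi>\<close> concave, hence
  \<open>\<Phi> s \<le> V (1 - \<tau> s / V)\<^sup>n\<close> globally. Integration over \<open>s\<close> gives \<open>vol K \<le> V\<^sup>2 / (\<tau> (n + 1))\<close>.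

  Sharpness. For the lattice of integer vectors and the simplex with vertices \<open>e\<^sub>1, \<dots>, e\<^sub>n\<close> and
  \<open>-(e\<^sub>1 + \<dots> + e\<^sub>n)\<close>, all packing minima are 1.
\<close>

section \<open>The Prekopa-Leindler inequality\<close>

text \<open>From \<open>4 a b \<le> (a + b)^2\<close>. The case \<open>c = top\<close> is trivial,
  and otherwise \<open>a\<close> and \<open>b\<close> are finite.\<close>

lemma ennreal_am_gm:
  fixes a b c :: ennreal
  assumes "a + b \<le> 2 * c"
  shows "a * b \<le> c\<^sup>2"
proof (cases "c = top")
  case True
  then show ?thesis by (simp add: power2_eq_square)
next
  case False
  then obtain z where z: "c = ennreal z" "0 \<le> z" by (cases c) auto
  have fin: "a + b < top"
    using assms z by (metis ennreal_less_top ennreal_mult_less_top ennreal_numeral le_less_trans)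
  then obtain x y where xy: "a = ennreal x" "0 \<le> x" "b = ennreal y" "0 \<le> y"
    by (cases a; cases b) auto
  have "ennreal (x + y) \<le> ennreal (2 * z)"
    using assms xy z by (simp add: ennreal_mult ennreal_plus)
  then have "x + y \<le> 2 * z" using z by (simp add: ennreal_le_iff)
  moreover have "4 * (x * y) \<le> (x + y)\<^sup>2"
    using zero_le_power2[of "x - y"] by (simp add: power2_eq_square algebra_simps)
  ultimately have "x * y \<le> z\<^sup>2"
    using power_mono[of "x + y" "2 * z" 2] xy by (simp add: power_mult_distrib)
  then show ?thesis using xy z
    by (simp add: ennreal_mult[symmetric] ennreal_power)
qed

section \<open>Midpoint sets on the line and the layer-cake formula\<close>

text \<open>A sequence in \<open>A\<close> increasing to \<open>Sup A\<close> covers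
  \<open>A\<close> by lower parts up to the single point \<open>Sup A\<close>, a null set;
  continuity from below does the rest. If the supremum is infinite, \<open>real_of_ereal\<close>
  merely adds a stray point.\<close>

lemma emeasure_le_of_lower_parts:
  fixes A :: "real set"
  assumes [measurable]: "A \<in> sets borel" and "A \<noteq> {}"
    and bd: "\<And>a. a \<in> A \<Longrightarrow> emeasure lborel (A \<inter> {..a}) \<le> K"
  shows "emeasure lborel A \<le> K"
proof -
  have "\<exists>f::nat \<Rightarrow> ereal. incseq f \<and> range f \<subseteq> ereal ` A \<and> Sup (ereal ` A) = (SUP i. f i)"
    using \<open>A \<noteq> {}\<close> by (intro Sup_countable_SUP) auto
  then obtain f :: "nat \<Rightarrow> ereal" where f: "incseq f" "range f \<subseteq> ereal ` A"
      "Sup (ereal ` A) = (SUP i. f i)" by blast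
  have "\<forall>i. \<exists>a. a \<in> A \<and> f i = ereal a" using f(2) by (auto simp: image_iff subset_iff)
  then obtain g where g: "\<And>i. g i \<in> A" "\<And>i. f i = ereal (g i)" by metis
  have inc: "incseq g" using f(1) g(2) by (auto simp: incseq_def)
  have sub: "A \<subseteq> (\<Union>i. A \<inter> {..g i}) \<union> {real_of_ereal (Sup (ereal ` A))}"
  proof
    fix x assume x: "x \<in> A"
    show "x \<in> (\<Union>i. A \<inter> {..g i}) \<union> {real_of_ereal (Sup (ereal ` A))}"
    proof (cases "\<exists>i. x \<le> g i")
      case False
      then have "\<And>i. f i \<le> ereal x" using g by (simp add: not_le less_imp_le)
      then have "Sup (ereal ` A) \<le> ereal x" using f(3) by (simp add: SUP_le_iff)
      moreover have "ereal x \<le> Sup (ereal ` A)" using x by (intro Sup_upper) auto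
      ultimately have "Sup (ereal ` A) = ereal x" by (rule antisym)
      then show ?thesis by simp
    qed (use x in auto)
  qed
  have "emeasure lborel A \<le> emeasure lborel ((\<Union>i. A \<inter> {..g i}) \<union> {real_of_ereal (Sup (ereal ` A))})"
    by (rule emeasure_mono[OF sub]) measurable
  also have "\<dots> = emeasure lborel (\<Union>i. A \<inter> {..g i})"
    by (intro emeasure_Un_null_set) (auto intro!: finite_imp_null_set_lborel)
  also have "\<dots> = (SUP i. emeasure lborel (A \<inter> {..g i}))"
    using inc by (intro SUP_emeasure_incseq[symmetric]) (auto simp: incseq_def intro: order_trans)
  also have "\<dots> \<le> K" using bd g(1) by (intro SUP_least) auto
  finally show ?thesis .
qed

lemma emeasure_lborel_affine_image:
  fixes S :: "real set"
  assumes "S \<in> sets borel" "m > 0"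
  shows "emeasure lborel ((\<lambda>x. m * x + d) ` S) = ennreal m * emeasure lborel S"
    and "(\<lambda>x. m * x + d) ` S \<in> sets borel"
proof -
  have im: "(\<lambda>x. m * x + d) ` S = (\<lambda>x. (x - d) / m) -` S"
    using assms(2) by (force simp: image_iff field_simps)
  show b: "(\<lambda>x. m * x + d) ` S \<in> sets borel"
    unfolding im using assms(1) measurable_sets_borel[of "\<lambda>x. (x - d) / m" borel S] by simp
  have "emeasure lebesgue ((\<lambda>x. m *\<^sub>R x + d) ` S) = \<bar>m\<bar> ^ DIM(real) * emeasure lebesgue S"
    by (rule emeasure_lebesgue_affine)
  then show "emeasure lborel ((\<lambda>x. m * x + d) ` S) = ennreal m * emeasure lborel S"
    using b assms by simp
qed

lemma ennreal_le_diff_iff: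
  fixes a b c :: ennreal
  assumes "a \<le> c" "a < top"
  shows "b \<le> c - a \<longleftrightarrow> a + b \<le> c"
proof
  assume "b \<le> c - a"
  then have "b + a \<le> (c - a) + a" by (rule add_right_mono)
  also have "(c - a) + a = c" by (rule diff_add_cancel_ennreal[OF assms(1)])
  finally show "a + b \<le> c" by (simp only: add.commute)
next
  assume "a + b \<le> c"
  then have "(a + b) - a \<le> c - a" by (rule ennreal_minus_mono) simp
  then show "b \<le> c - a" using assms by simp
qed

text \<open>The one-dimensional Brunn-Minkowski inequality. If \<open>a\<close> is the maximum of
  \<open>A\<close> and \<open>b\<close> the minimum of \<open>B\<close>, then
  \<open>(A + b) / 2\<close> and \<open>(a + B) / 2\<close> lie in \<open>C\<close> on opposite
  sides of \<open>(a + b) / 2\<close>, so their lengths add up. In general \<open>A\<close> is cut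
  off above some \<open>a\<close> and \<open>B\<close> below some \<open>b\<close>, and both cuts
  are then pushed outwards.\<close>

lemma emeasure_lborel_midpoints_real:
  fixes A B C :: "real set"
  assumes [measurable]: "A \<in> sets borel" "B \<in> sets borel" "C \<in> sets borel"
    and "A \<noteq> {}" "B \<noteq> {}"
    and mid: "\<And>a b. a \<in> A \<Longrightarrow> b \<in> B \<Longrightarrow> (a + b) / 2 \<in> C"
  shows "emeasure lborel A + emeasure lborel B \<le> 2 * emeasure lborel C"
proof -
  have *: "emeasure lborel (A \<inter> {..a}) + emeasure lborel (B \<inter> {b..}) \<le> 2 * emeasure lborel C"
    if ab: "a \<in> A" "b \<in> B" for a b
  proof -
    define m where "m = (a + b) / 2"
    have "A \<inter> {..a} \<subseteq> (\<lambda>x. 2 * x + (- b)) ` (C \<inter> {..m})"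
    proof
      fix x assume "x \<in> A \<inter> {..a}"
      then have "(x + b) / 2 \<in> C \<inter> {..m}" using mid ab by (auto simp: m_def)
      then have i: "2 * ((x + b) / 2) + (- b) \<in> (\<lambda>x. 2 * x + (- b)) ` (C \<inter> {..m})" by (rule imageI)
      have j: "2 * ((x + b) / 2) + (- b) = x" by (simp add: field_simps)
      from i show "x \<in> (\<lambda>x. 2 * x + (- b)) ` (C \<inter> {..m})" by (simp only: j)
    qed
    then have 1: "emeasure lborel (A \<inter> {..a}) \<le> 2 * emeasure lborel (C \<inter> {..m})"
      using emeasure_mono[of "A \<inter> {..a}" "(\<lambda>x. 2 * x + (- b)) ` (C \<inter> {..m})" lborel]
        emeasure_lborel_affine_image[of "C \<inter> {..m}" 2 "- b"] by simp
    have "B \<inter> {b..} \<subseteq> (\<lambda>x. 2 * x + (- a)) ` (C \<inter> {m..})"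
    proof
      fix x assume "x \<in> B \<inter> {b..}"
      then have "(a + x) / 2 \<in> C \<inter> {m..}" using mid ab by (auto simp: m_def)
      then have i: "2 * ((a + x) / 2) + (- a) \<in> (\<lambda>x. 2 * x + (- a)) ` (C \<inter> {m..})" by (rule imageI)
      have j: "2 * ((a + x) / 2) + (- a) = x" by (simp add: field_simps)
      from i show "x \<in> (\<lambda>x. 2 * x + (- a)) ` (C \<inter> {m..})" by (simp only: j)
    qed
    then have 2: "emeasure lborel (B \<inter> {b..}) \<le> 2 * emeasure lborel (C \<inter> {m..})"
      using emeasure_mono[of "B \<inter> {b..}" "(\<lambda>x. 2 * x + (- a)) ` (C \<inter> {m..})" lborel]
        emeasure_lborel_affine_image[of "C \<inter> {m..}" 2 "- a"] by simp
    \<comment> \<open>The common point \<open>m\<close> of the two halves is a null set, so it may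
      be assigned to the left half only.\<close>
    have "emeasure lborel (C \<inter> {m..}) \<le> emeasure lborel ((C \<inter> {m<..}) \<union> {m})"
      by (rule emeasure_mono) auto
    also have "\<dots> = emeasure lborel (C \<inter> {m<..})"
      by (intro emeasure_Un_null_set) (auto intro!: finite_imp_null_set_lborel)
    finally have 3: "emeasure lborel (C \<inter> {m..}) \<le> emeasure lborel (C \<inter> {m<..})" .
    have "emeasure lborel (C \<inter> {..m}) + emeasure lborel (C \<inter> {m<..})
        = emeasure lborel ((C \<inter> {..m}) \<union> (C \<inter> {m<..}))"
      by (rule plus_emeasure) auto
    also have "(C \<inter> {..m}) \<union> (C \<inter> {m<..}) = C" by auto
    finally have 4: "emeasure lborel (C \<inter> {..m}) + emeasure lborel (C \<inter> {m<..}) = emeasure lborel C" .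
    have "emeasure lborel (A \<inter> {..a}) + emeasure lborel (B \<inter> {b..})
        \<le> 2 * emeasure lborel (C \<inter> {..m}) + 2 * emeasure lborel (C \<inter> {m<..})"
      by (intro add_mono 1 order_trans[OF 2 mult_left_mono[OF 3]]) simp
    then show ?thesis using 4 by (simp add: distrib_left[symmetric])
  qed
  \<comment> \<open>Reflection at 0 turns upper parts of \<open>B\<close> into lower parts of its
    mirror image.\<close>
  have B': "emeasure lborel B \<le> K"
    if "\<And>b. b \<in> B \<Longrightarrow> emeasure lborel (B \<inter> {b..}) \<le> K" for K
  proof -
    have neg: "emeasure lborel (uminus ` S) = emeasure lborel S" "uminus ` S \<in> sets borel"
      if S: "S \<in> sets borel" for S :: "real set"
    proof -
      have "uminus ` S = uminus -` S" by (force simp: image_iff)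
      then show b: "uminus ` S \<in> sets borel"
        using measurable_sets_borel[of uminus borel S] S by simp
      have "emeasure lebesgue ((\<lambda>x. (- 1) *\<^sub>R x + 0) ` S) = ennreal (\<bar>- 1\<bar> ^ DIM(real)) * emeasure lebesgue S"
        by (rule emeasure_lebesgue_affine)
      then show "emeasure lborel (uminus ` S) = emeasure lborel S" using S b by simp
    qed
    have "emeasure lborel (uminus ` B) \<le> K"
    proof (rule emeasure_le_of_lower_parts)
      fix a assume "a \<in> uminus ` B"
      then have a: "- a \<in> B" by auto
      have "uminus ` B \<inter> {..a} = uminus ` (B \<inter> {- a..})" by force
      then show "emeasure lborel (uminus ` B \<inter> {..a}) \<le> K"
        using that[OF a] neg(1)[of "B \<inter> {- a..}"] by simp
    qed (use neg(2) \<open>B \<noteq> {}\<close> in auto)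
    then show ?thesis using neg by simp
  qed
  let ?K = "2 * emeasure lborel C"
  show ?thesis
  proof (cases "?K = top")
    case False
    \<comment> \<open>As \<open>?K\<close> is finite, a measure can be isolated by subtraction
      before its cut is removed: first for \<open>B\<close> with \<open>a\<close> fixed, then for
      \<open>A\<close>.\<close>
    have part: "emeasure lborel (A \<inter> {..a}) + emeasure lborel B \<le> ?K" if a: "a \<in> A" for a
    proof -
      have le: "emeasure lborel (A \<inter> {..a}) \<le> ?K"
      proof -
        obtain b where "b \<in> B" using \<open>B \<noteq> {}\<close> by blast
        have "emeasure lborel (A \<inter> {..a}) \<le> emeasure lborel (A \<inter> {..a}) + emeasure lborel (B \<inter> {b..})"
          by (rule add_increasing2) simp_all
        also note *[OF a \<open>b \<in> B\<close>]
        finally show ?thesis .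
      qed
      then have fin: "emeasure lborel (A \<inter> {..a}) < top"
        using False by (simp add: less_top[symmetric] neq_top_trans)
      have "emeasure lborel B \<le> ?K - emeasure lborel (A \<inter> {..a})"
        by (rule B') (simp only: ennreal_le_diff_iff[OF le fin] *[OF a])
      then show ?thesis by (simp only: ennreal_le_diff_iff[OF le fin])
    qed
    have bK: "emeasure lborel B \<le> ?K"
    proof -
      obtain a where "a \<in> A" using \<open>A \<noteq> {}\<close> by blast
      have "emeasure lborel B \<le> emeasure lborel (A \<inter> {..a}) + emeasure lborel B"
        by (rule add_increasing) simp_all
      also note part[OF \<open>a \<in> A\<close>]
      finally show ?thesis .
    qed
    then have fin: "emeasure lborel B < top"
      using False by (simp add: less_top[symmetric] neq_top_trans)
    have "emeasure lborel A \<le> ?K - emeasure lborel B"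
    proof (rule emeasure_le_of_lower_parts)
      fix a assume "a \<in> A"
      then show "emeasure lborel (A \<inter> {..a}) \<le> ?K - emeasure lborel B"
        using part[of a] by (simp only: ennreal_le_diff_iff[OF bK fin] add.commute)
    qed (use \<open>A \<noteq> {}\<close> in auto)
    then show ?thesis by (simp only: ennreal_le_diff_iff[OF bK fin] add.commute)
  qed simp
qed

text \<open>A value \<open>v\<close> is the length of the set of \<open>t \<ge> 0\<close> below
  \<open>v\<close>; Fubini then exchanges the integrals over \<open>x\<close> and
  \<open>t\<close>.\<close>

lemma nn_integral_layer_cake:
  fixes f :: "'a::euclidean_space \<Rightarrow> ennreal"
  assumes [measurable]: "f \<in> borel_measurable borel"
  shows "(\<integral>\<^sup>+x. f x \<partial>lborel) = (\<integral>\<^sup>+t. (if 0 \<le> t then emeasure lborel {x. ennreal t < f x} else 0) \<partial>lborel)"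
proof -
  have layer: "(\<integral>\<^sup>+t. (if 0 \<le> t \<and> ennreal t < v then 1 else 0) \<partial>lborel) = v" for v
  proof (cases v)
    case (real r)
    have "(\<integral>\<^sup>+t. (if 0 \<le> t \<and> ennreal t < v then 1 else 0) \<partial>lborel) = (\<integral>\<^sup>+t. indicator {0..<r} t \<partial>lborel)"
      using real by (intro nn_integral_cong) (auto simp: indicator_def ennreal_less_iff)
    then show ?thesis using real by simp
  next
    case top
    have "(\<integral>\<^sup>+t. (if 0 \<le> t \<and> ennreal t < v then 1 else 0) \<partial>lborel) = (\<integral>\<^sup>+t. indicator {0::real..} t \<partial>lborel)"
      using top by (intro nn_integral_cong) (auto simp: indicator_def)
    also have "\<dots> = emeasure lborel {0::real..}" by simp
    also have "\<dots> = top"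
    proof (rule ccontr)
      assume n: "emeasure lborel {0::real..} \<noteq> top"
      then obtain r where r: "emeasure lborel {0::real..} = ennreal r" "0 \<le> r"
        by (cases "emeasure lborel {0::real..}") auto
      have "emeasure lborel {0..r + 1} \<le> emeasure lborel {0::real..}" by (rule emeasure_mono) auto
      then show False using r by (simp add: ennreal_le_iff)
    qed
    finally show ?thesis using top by simp
  qed
  have "(\<integral>\<^sup>+x. f x \<partial>lborel) = (\<integral>\<^sup>+x. (\<integral>\<^sup>+t. (if 0 \<le> t \<and> ennreal t < f x then 1 else 0) \<partial>lborel) \<partial>lborel)"
    by (simp add: layer)
  also have "\<dots> = (\<integral>\<^sup>+t. (\<integral>\<^sup>+x. (if 0 \<le> t \<and> ennreal t < f x then 1 else 0) \<partial>lborel) \<partial>lborel)"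
    by (rule lborel_pair.Fubini') measurable
  also have "\<dots> = (\<integral>\<^sup>+t. (if 0 \<le> t then emeasure lborel {x. ennreal t < f x} else 0) \<partial>lborel)"
  proof (rule nn_integral_cong)
    fix t :: real
    have "(\<integral>\<^sup>+x. (if ennreal t < f x then 1 else 0) \<partial>lborel) = (\<integral>\<^sup>+x. indicator {x. ennreal t < f x} x \<partial>lborel)"
      by (intro nn_integral_cong) (auto simp: indicator_def)
    then show "(\<integral>\<^sup>+x. (if 0 \<le> t \<and> ennreal t < f x then 1 else 0) \<partial>lborel) = (if 0 \<le> t then emeasure lborel {x. ennreal t < f x} else 0)"
      by simp
  qed
  finally show ?thesis .
qed

section \<open>The inequality on the line\<close>

text \<open>Midpoints of the superlevel sets of \<open>f\<close> and \<open>g\<close> at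
  \<open>t\<close> lie in that of \<open>h\<close>. Since both suprema are 1, the sets for
  \<open>f\<close> and \<open>g\<close> are nonempty for all \<open>t < 1\<close> and empty from 1
  on, so Brunn-Minkowski applies level by level. Integration over \<open>t\<close> gives an additive
  inequality, which implies the product form by AM-GM.\<close>

lemma prekopa_leindler_real_normalized:
  fixes f g h :: "real \<Rightarrow> ennreal"
  assumes [measurable]: "f \<in> borel_measurable borel" "g \<in> borel_measurable borel" "h \<in> borel_measurable borel"
    and mid: "\<And>x y. f x * g y \<le> (h ((x + y) / 2))\<^sup>2"
    and sup: "(SUP x. f x) = 1" "(SUP x. g x) = 1"
  shows "(\<integral>\<^sup>+x. f x \<partial>lborel) * (\<integral>\<^sup>+x. g x \<partial>lborel) \<le> (\<integral>\<^sup>+x. h x \<partial>lborel)\<^sup>2"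
proof (rule ennreal_am_gm)
  have f1: "f x \<le> 1" and g1: "g x \<le> 1" for x
    using sup SUP_upper[of x UNIV f] SUP_upper[of x UNIV g] by simp_all
  have lev: "emeasure lborel {x. ennreal t < f x} + emeasure lborel {x. ennreal t < g x}
      \<le> 2 * emeasure lborel {x. ennreal t < h x}" if t: "0 \<le> t" for t
  proof (cases "t < 1")
    case True
    then have t1: "ennreal t < 1" using t by (simp add: ennreal_less_iff flip: ennreal_1)
    show ?thesis
    proof (rule emeasure_lborel_midpoints_real)
      show "{x. ennreal t < f x} \<noteq> {}" using t1 less_SUP_iff[of "ennreal t" f UNIV] sup by auto
      show "{x. ennreal t < g x} \<noteq> {}" using t1 less_SUP_iff[of "ennreal t" g UNIV] sup by auto
      fix a b assume "a \<in> {x. ennreal t < f x}" "b \<in> {x. ennreal t < g x}"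
      then have ab: "ennreal t < f a" "ennreal t < g b" by auto
      have "f a < top" "g b < top" using f1[of a] g1[of b] by (auto intro: le_less_trans)
      then obtain p q where pq: "f a = ennreal p" "0 \<le> p" "g b = ennreal q" "0 \<le> q"
        by (cases "f a"; cases "g b") auto
      have tp: "t < p" "t < q" using ab pq t by (auto simp: ennreal_less_iff)
      have "ennreal t < h ((a + b) / 2)"
      proof (rule ccontr)
        assume "\<not> ennreal t < h ((a + b) / 2)"
        then have "(h ((a + b) / 2))\<^sup>2 \<le> (ennreal t)\<^sup>2" by (intro power_mono) auto
        then have "f a * g b \<le> (ennreal t)\<^sup>2" using mid by (rule order_trans[rotated])
        then have "p * q \<le> t\<^sup>2" using pq t by (simp add: ennreal_mult[symmetric] ennreal_power ennreal_le_iff)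
        moreover have "t * t < p * q" using tp t by (intro mult_strict_mono) auto
        ultimately show False by (simp add: power2_eq_square)
      qed
      then show "(a + b) / 2 \<in> {x. ennreal t < h x}" by simp
    qed measurable
  next
    case False
    then have t1: "1 \<le> ennreal t" using t by (simp flip: ennreal_1 add: ennreal_le_iff)
    have "{x. ennreal t < f x} = {}" "{x. ennreal t < g x} = {}"
      using order_trans[OF f1 t1] order_trans[OF g1 t1] by (auto simp: not_less)
    then show ?thesis by simp
  qed
  have "(\<integral>\<^sup>+x. f x \<partial>lborel) + (\<integral>\<^sup>+x. g x \<partial>lborel)
      = (\<integral>\<^sup>+t. ((if 0 \<le> t then emeasure lborel {x. ennreal t < f x} else 0)
          + (if 0 \<le> t then emeasure lborel {x. ennreal t < g x} else 0)) \<partial>lborel)"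
    by (subst (1 2) nn_integral_layer_cake, measurable, subst nn_integral_add) measurable
  also have "\<dots> \<le> (\<integral>\<^sup>+t. 2 * (if 0 \<le> t then emeasure lborel {x. ennreal t < h x} else 0) \<partial>lborel)"
    using lev by (intro nn_integral_mono) auto
  also have "\<dots> = 2 * (\<integral>\<^sup>+x. h x \<partial>lborel)"
    by (subst nn_integral_layer_cake[of h], measurable, subst nn_integral_cmult) measurable
  finally show "(\<integral>\<^sup>+x. f x \<partial>lborel) + (\<integral>\<^sup>+x. g x \<partial>lborel) \<le> 2 * (\<integral>\<^sup>+x. h x \<partial>lborel)" .
qed

text \<open>Dividing \<open>f\<close> and \<open>g\<close> by their suprema \<open>a\<close> and
  \<open>b\<close>, and \<open>h\<close> by \<open>sqrt (a * b)\<close>, preserves the midpoint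
  hypothesis. If a supremum vanishes, the left side is 0.\<close>

lemma prekopa_leindler_real_bounded:
  fixes f g h :: "real \<Rightarrow> ennreal"
  assumes [measurable]: "f \<in> borel_measurable borel" "g \<in> borel_measurable borel" "h \<in> borel_measurable borel"
    and mid: "\<And>x y. f x * g y \<le> (h ((x + y) / 2))\<^sup>2"
    and bdd: "(SUP x. f x) < top" "(SUP x. g x) < top"
  shows "(\<integral>\<^sup>+x. f x \<partial>lborel) * (\<integral>\<^sup>+x. g x \<partial>lborel) \<le> (\<integral>\<^sup>+x. h x \<partial>lborel)\<^sup>2"
proof (cases "(SUP x. f x) = 0 \<or> (SUP x. g x) = 0")
  case True
  have "f x \<le> (SUP x. f x)" "g x \<le> (SUP x. g x)" for x by (auto intro: SUP_upper)
  then have "(\<forall>x. f x = 0) \<or> (\<forall>x. g x = 0)" using True by auto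
  then show ?thesis by auto
next
  case False
  obtain a b where ab: "(SUP x. f x) = ennreal a" "0 \<le> a" "(SUP x. g x) = ennreal b" "0 \<le> b"
    using bdd by (cases "SUP x. f x"; cases "SUP x. g x") auto
  then have pos: "0 < a" "0 < b" using False by (auto simp: less_le)
  define p q r where "p = ennreal (1 / a)" and "q = ennreal (1 / b)" and "r = ennreal (1 / sqrt (a * b))"
  have r2: "r\<^sup>2 = p * q"
    using pos by (simp add: r_def p_def q_def ennreal_power ennreal_mult[symmetric] power_divide)
  have "(\<integral>\<^sup>+x. p * f x \<partial>lborel) * (\<integral>\<^sup>+x. q * g x \<partial>lborel) \<le> (\<integral>\<^sup>+x. r * h x \<partial>lborel)\<^sup>2"
  proof (rule prekopa_leindler_real_normalized)
    show "(SUP x. p * f x) = 1" "(SUP x. q * g x) = 1"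
      using pos by (simp_all add: SUP_mult_left_ennreal[symmetric] ab p_def q_def ennreal_mult[symmetric])
    fix x y
    have "p * f x * (q * g y) = (p * q) * (f x * g y)" by (simp add: mult_ac)
    also have "\<dots> \<le> (p * q) * (h ((x + y) / 2))\<^sup>2" by (intro mult_left_mono mid) auto
    also have "\<dots> = (r * h ((x + y) / 2))\<^sup>2" by (simp add: power_mult_distrib r2)
    finally show "p * f x * (q * g y) \<le> (r * h ((x + y) / 2))\<^sup>2" .
  qed measurable
  then have "(p * q) * ((\<integral>\<^sup>+x. f x \<partial>lborel) * (\<integral>\<^sup>+x. g x \<partial>lborel)) \<le> (p * q) * (\<integral>\<^sup>+x. h x \<partial>lborel)\<^sup>2"
    by (simp add: nn_integral_cmult power_mult_distrib r2 mult_ac)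
  moreover have "p * q \<noteq> 0" "p * q \<noteq> top"
    using pos by (auto simp: p_def q_def ennreal_mult_eq_top_iff)
  ultimately show ?thesis by (simp add: ennreal_mult_le_mult_iff)
qed

lemma SUP_min_of_nat_ennreal: "(SUP k. min v (of_nat k)) = (v :: ennreal)"
proof -
  have "(SUP k. inf v (of_nat k)) = inf v (SUP k. of_nat k)" by (rule inf_SUP[symmetric])
  then show ?thesis unfolding inf_min by (simp add: ennreal_SUP_of_nat_eq_top)
qed

lemma nn_integral_truncate_SUP:
  assumes [measurable]: "f \<in> borel_measurable M"
  shows "(\<integral>\<^sup>+x. f x \<partial>M) = (SUP k. \<integral>\<^sup>+x. min (f x) (of_nat k) \<partial>M)"
proof -
  have "(\<integral>\<^sup>+x. f x \<partial>M) = (\<integral>\<^sup>+x. (SUP k. min (f x) (of_nat k)) \<partial>M)"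
    by (simp only: SUP_min_of_nat_ennreal)
  also have "\<dots> = (SUP k. \<integral>\<^sup>+x. min (f x) (of_nat k) \<partial>M)"
  proof (rule nn_integral_monotone_convergence_SUP)
    show "incseq (\<lambda>k x. min (f x) (of_nat k :: ennreal))"
      unfolding incseq_def le_fun_def by (metis min.mono of_nat_mono order_refl)
  qed measurable
  finally show ?thesis .
qed
  
text \<open>Measurability of the partial integral over all coordinates but \<open>i\<close>, for the
  induction over the coordinates.\<close>

lemma (in product_sigma_finite) borel_measurable_nn_integral_fun_upd:
  assumes [simp]: "finite I" "i \<notin> I"
    and [measurable]: "f \<in> borel_measurable (Pi\<^sub>M (insert i I) M)"
  shows "(\<lambda>a. \<integral>\<^sup>+x. f (x(i := a)) \<partial>Pi\<^sub>M I M) \<in> borel_measurable (M i)"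
proof -
  interpret finite_product_sigma_finite M I by standard simp
  show ?thesis by measurable
qed
text \<open>Truncating \<open>f\<close> and \<open>g\<close> at natural numbers keeps the midpoint
  hypothesis with the same \<open>h\<close>; monotone convergence removes the truncation.\<close>

lemma prekopa_leindler_real:
  fixes f g h :: "real \<Rightarrow> ennreal"
  assumes [measurable]: "f \<in> borel_measurable borel" "g \<in> borel_measurable borel" "h \<in> borel_measurable borel"
    and mid: "\<And>x y. f x * g y \<le> (h ((x + y) / 2))\<^sup>2"
  shows "(\<integral>\<^sup>+x. f x \<partial>lborel) * (\<integral>\<^sup>+x. g x \<partial>lborel) \<le> (\<integral>\<^sup>+x. h x \<partial>lborel)\<^sup>2"
proof -
  have "(\<integral>\<^sup>+x. min (f x) (of_nat k) \<partial>lborel) * (\<integral>\<^sup>+x. min (g x) (of_nat l) \<partial>lborel)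
      \<le> (\<integral>\<^sup>+x. h x \<partial>lborel)\<^sup>2" for k l
  proof (rule prekopa_leindler_real_bounded)
    have *: "(SUP x. min (u x) (of_nat k)) < top" for u :: "real \<Rightarrow> ennreal" and k
      by (rule le_less_trans[OF SUP_least of_nat_less_top[of k]]) simp
    show "(SUP x. min (f x) (of_nat k)) < top" "(SUP x. min (g x) (of_nat l)) < top" by (rule *)+
    fix x y
    have "min (f x) (of_nat k) * min (g y) (of_nat l) \<le> f x * g y" by (intro mult_mono) auto
    then show "min (f x) (of_nat k) * min (g y) (of_nat l) \<le> (h ((x + y) / 2))\<^sup>2"
      using mid order_trans by blast
  qed measurable
  then have "(SUP k. \<integral>\<^sup>+x. min (f x) (of_nat k) \<partial>lborel) * (SUP l. \<integral>\<^sup>+x. min (g x) (of_nat l) \<partial>lborel)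
      \<le> (\<integral>\<^sup>+x. h x \<partial>lborel)\<^sup>2"
    unfolding SUP_mult_right_ennreal SUP_mult_left_ennreal by (intro SUP_least)
  moreover have f: "f \<in> borel_measurable lborel" and g: "g \<in> borel_measurable lborel" by simp_all
  ultimately show ?thesis
    by (simp only: nn_integral_truncate_SUP[OF f, symmetric]
        nn_integral_truncate_SUP[OF g, symmetric])
qed

section \<open>Higher dimensions\<close>

text \<open>Induction over the coordinates. The induction hypothesis, applied to the sections at
  \<open>a\<close>, \<open>b\<close> and \<open>(a + b) / 2\<close>, says that the partial integrals
  satisfy the one-dimensional midpoint hypothesis.\<close>

lemma prekopa_leindler_PiM:
  fixes f g h :: "('i \<Rightarrow> real) \<Rightarrow> ennreal"
  assumes "finite I"
    and "f \<in> borel_measurable (Pi\<^sub>M I (\<lambda>_. lborel))" "g \<in> borel_measurable (Pi\<^sub>M I (\<lambda>_. lborel))"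
      "h \<in> borel_measurable (Pi\<^sub>M I (\<lambda>_. lborel))"
    and "\<And>x y. x \<in> space (Pi\<^sub>M I (\<lambda>_. lborel :: real measure)) \<Longrightarrow> y \<in> space (Pi\<^sub>M I (\<lambda>_. lborel :: real measure))
      \<Longrightarrow> f x * g y \<le> (h (\<lambda>i\<in>I. (x i + y i) / 2))\<^sup>2"
  shows "(\<integral>\<^sup>+x. f x \<partial>Pi\<^sub>M I (\<lambda>_. lborel)) * (\<integral>\<^sup>+x. g x \<partial>Pi\<^sub>M I (\<lambda>_. lborel)) \<le> (\<integral>\<^sup>+x. h x \<partial>Pi\<^sub>M I (\<lambda>_. lborel))\<^sup>2"
  using assms
proof (induction I arbitrary: f g h rule: finite_induct)
  case empty
  have "(\<lambda>i\<in>{}. (x i + y i) / 2) = (\<lambda>_. undefined)" for x y :: "'i \<Rightarrow> real" by auto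
  then show ?case using empty(4)[of "\<lambda>_. undefined" "\<lambda>_. undefined"]
    by (simp add: PiM_empty nn_integral_count_space_finite)
next
  case (insert i I)
  interpret product_sigma_finite "\<lambda>_ :: 'i. lborel :: real measure" by standard
  note [simp] = insert.hyps and [measurable] = insert.prems(1-3)
  let ?F = "\<lambda>f a. \<integral>\<^sup>+x. f (x(i := a)) \<partial>Pi\<^sub>M I (\<lambda>_. lborel)"
  have meas: "?F f \<in> borel_measurable borel"
    if "f \<in> borel_measurable (Pi\<^sub>M (insert i I) (\<lambda>_. lborel))" for f :: "('i \<Rightarrow> real) \<Rightarrow> ennreal"
  proof -
    have "?F f \<in> borel_measurable lborel"
      by (rule borel_measurable_nn_integral_fun_upd[OF insert.hyps that])
    then show ?thesis by simp
  qed
  have "?F f a * ?F g b \<le> (?F h ((a + b) / 2))\<^sup>2" for a b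
  proof (rule insert.IH)
    fix x y
    assume x: "x \<in> space (Pi\<^sub>M I (\<lambda>_. lborel :: real measure))" and y: "y \<in> space (Pi\<^sub>M I (\<lambda>_. lborel :: real measure))"
    have "(\<lambda>j\<in>insert i I. ((x(i := a)) j + (y(i := b)) j) / 2) = (\<lambda>j\<in>I. (x j + y j) / 2)(i := (a + b) / 2)"
      using insert.hyps(2) by (auto simp: fun_eq_iff restrict_def)
    moreover have "f (x(i := a)) * g (y(i := b))
        \<le> (h (\<lambda>j\<in>insert i I. ((x(i := a)) j + (y(i := b)) j) / 2))\<^sup>2"
      using x y by (intro insert.prems(4)) (auto simp: space_PiM PiE_def extensional_def)
    ultimately show "f (x(i := a)) * g (y(i := b)) \<le> (h ((\<lambda>j\<in>I. (x j + y j) / 2)(i := (a + b) / 2)))\<^sup>2"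
      by (simp only:)
  qed measurable
  then have "(\<integral>\<^sup>+a. ?F f a \<partial>lborel) * (\<integral>\<^sup>+a. ?F g a \<partial>lborel) \<le> (\<integral>\<^sup>+a. ?F h a \<partial>lborel)\<^sup>2"
    by (intro prekopa_leindler_real meas insert.prems(1-3))
  then show ?case
    by (simp add: product_nn_integral_insert_rev)
qed

text \<open>Lebesgue measure is the image of the product measure under the coordinate map
  \<open>?T\<close>, which is compatible with midpoints.\<close>

theorem prekopa_leindler:
  fixes f g h :: "'a::euclidean_space \<Rightarrow> ennreal"
  assumes [measurable]: "f \<in> borel_measurable borel" "g \<in> borel_measurable borel" "h \<in> borel_measurable borel"
    and mid: "\<And>x y. f x * g y \<le> (h ((1/2) *\<^sub>R (x + y)))\<^sup>2"
  shows "(\<integral>\<^sup>+x. f x \<partial>lborel) * (\<integral>\<^sup>+x. g x \<partial>lborel) \<le> (\<integral>\<^sup>+x. h x \<partial>lborel)\<^sup>2"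
proof -
  let ?T = "\<lambda>x. \<Sum>b\<in>Basis. x b *\<^sub>R (b :: 'a)"
  have [measurable]: "?T \<in> Pi\<^sub>M Basis (\<lambda>_. lborel) \<rightarrow>\<^sub>M borel" by measurable
  have int: "(\<integral>\<^sup>+x. f x \<partial>lborel) = (\<integral>\<^sup>+x. f (?T x) \<partial>Pi\<^sub>M Basis (\<lambda>_. lborel))"
    if [measurable]: "f \<in> borel_measurable borel" for f :: "'a \<Rightarrow> ennreal"
    by (subst lborel_eq, subst nn_integral_distr) auto
  have T: "?T (\<lambda>b\<in>Basis. (x b + y b) / 2) = (1/2) *\<^sub>R (?T x + ?T y)" for x y
    by (simp add: scaleR_sum_right scaleR_add_left add_divide_distrib sum.distrib scaleR_right_distrib)
  show ?thesis
    unfolding int[OF assms(1)] int[OF assms(2)] int[OF assms(3)]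
  proof (rule prekopa_leindler_PiM)
    fix x y
    show "f (?T x) * g (?T y) \<le> (h (?T (\<lambda>b\<in>Basis. (x b + y b) / 2)))\<^sup>2"
      unfolding T by (rule mid)
  qed measurable
qed

text \<open>Brunn-Minkowski in multiplicative form: the indicators of \<open>A\<close>,
  \<open>B\<close> and \<open>C\<close> satisfy the midpoint hypothesis.\<close>

lemma measure_midpoints_le:
  fixes A B C :: "'a::euclidean_space set"
  assumes "compact A" "compact B" "compact C"
    and mid: "\<And>a b. a \<in> A \<Longrightarrow> b \<in> B \<Longrightarrow> (1/2) *\<^sub>R (a + b) \<in> C"
  shows "measure lebesgue A * measure lebesgue B \<le> (measure lebesgue C)\<^sup>2"
proof -
  have [measurable]: "A \<in> sets borel" "B \<in> sets borel" "C \<in> sets borel"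
    using assms by (auto intro: borel_compact)
  have "(\<integral>\<^sup>+x. indicator A x \<partial>lborel) * (\<integral>\<^sup>+x. indicator B x \<partial>lborel) \<le> (\<integral>\<^sup>+x. indicator C x \<partial>lborel)\<^sup>2"
    using mid by (intro prekopa_leindler) (auto simp: indicator_def)
  then have le: "emeasure lborel A * emeasure lborel B \<le> (emeasure lborel C)\<^sup>2" by simp
  have e: "emeasure lborel S = ennreal (measure lebesgue S)" if "compact S" for S :: "'a set"
    using emeasure_compact_finite[OF that] borel_compact[OF that]
    by (simp add: emeasure_eq_ennreal_measure)
  show ?thesis
    using le by (simp add: e assms ennreal_mult[symmetric] ennreal_power ennreal_le_iff)
qed

section \<open>Volumes under linear maps\<close>

text \<open>The library version of the next lemma assumes a well-ordered index type.\<close>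

lemma
  fixes f :: "real ^ 'n \<Rightarrow> real ^ 'n"
  assumes "linear f" "S \<in> lmeasurable"
  shows lmeasurable_linear_image: "f ` S \<in> lmeasurable"
    and measure_lebesgue_linear_image:
      "measure lebesgue (f ` S) = \<bar>det (matrix f)\<bar> * measure lebesgue S"
proof -
  let ?P = "\<lambda>f :: real ^ 'n \<Rightarrow> real ^ 'n. \<forall>S \<in> lmeasurable. f ` S \<in> lmeasurable \<and>
    measure lebesgue (f ` S) = \<bar>det (matrix f)\<bar> * measure lebesgue S"
  \<comment> \<open>A linear map with determinant of modulus 1 only has to be tested on boxes; this
    serves coordinate swaps and shears.\<close>
  have boxes: "?P g" if g: "linear g" "\<bar>det (matrix g)\<bar> = 1"
    "\<And>a b. measure lebesgue (g ` cbox a b) = measure lebesgue (cbox a b)" for g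
  proof
    fix S :: "(real ^ 'n) set" assume S: "S \<in> lmeasurable"
    show "g ` S \<in> lmeasurable \<and> measure lebesgue (g ` S) = \<bar>det (matrix g)\<bar> * measure lebesgue S"
      using measure_linear_sufficient[OF g(1) S, of 1] g(2,3) by simp
  qed
  have "?P f"
  \<comment> \<open>Linear maps are composed of maps with a vanishing coordinate, diagonal maps,
    coordinate swaps and shears, and both sides are compatible with composition.\<close>
  proof (rule induct_linear_elementary[OF assms(1)])
    fix f g :: "real ^ 'n \<Rightarrow> real ^ 'n"
    assume lin: "linear f" "linear g" and P: "?P f" "?P g"
    have "det (matrix (f \<circ> g)) = det (matrix f) * det (matrix g)"
      by (simp add: matrix_compose lin det_mul)
    then show "?P (f \<circ> g)"
      using P by (simp only: image_comp [symmetric] abs_mult) simp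
  next
    fix f :: "real ^ 'n \<Rightarrow> real ^ 'n" and i assume f: "linear f" "\<And>x. f x $ i = 0"
    have "\<not> surj f"
    proof
      assume "surj f"
      then obtain x where "f x = axis i 1" by (metis surjD)
      then show False using f(2)[of x] by simp
    qed
    then have ni: "\<not> inj f" using linear_injective_imp_surjective[OF f(1)] by blast
    then have "det (matrix f) = 0" using det_nz_iff_inj[OF f(1)] by blast
    then show "?P f"
      using negligible_linear_singular_image[OF f(1) ni] negligible_imp_measurable negligible_imp_measure0
      by auto
  next
    fix c :: "'n \<Rightarrow> real"
    have "matrix (\<lambda>x. \<chi> i. c i * x $ i) = (\<chi> i j. if i = j then c i else 0)"
      by (auto simp: matrix_def axis_def vec_eq_iff)
    then show "?P (\<lambda>x. \<chi> i. c i * x $ i)"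
      by (simp add: measurable_stretch measure_stretch det_diagonal)
  next
    fix m n :: 'n assume "m \<noteq> n"
    let ?t = "Transposition.transpose m n"
    let ?h = "\<lambda>x :: real ^ 'n. \<chi> i. x $ ?t i"
    have lin: "linear ?h" by (rule linearI) (simp_all add: vec_eq_iff)
    have "matrix ?h = (\<chi> i. (mat 1 :: real ^ 'n ^ 'n) $ ?t i)"
      by (simp add: matrix_def mat_def axis_def vec_eq_iff)
    then have d: "\<bar>det (matrix ?h)\<bar> = 1"
      by (simp add: det_permute_rows permutes_swap_id sign_swap_id abs_mult)
    have "?h ` cbox a b = cbox (?h a) (?h b)" for a b
    proof (intro equalityI subsetI)
      fix x assume x: "x \<in> cbox (?h a) (?h b)"
      have "a $ i \<le> x $ ?t i \<and> x $ ?t i \<le> b $ i" for i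
        using x by (simp add: mem_box_cart) (metis transpose_involutory)
      then have "?h x \<in> cbox a b" by (simp add: mem_box_cart)
      moreover have "x = ?h (?h x)" by (simp add: vec_eq_iff)
      ultimately show "x \<in> ?h ` cbox a b" by (rule rev_image_eqI)
    qed (auto simp: mem_box_cart)
    moreover have "measure lborel (cbox (?h a) (?h b)) = measure lborel (cbox a b)" for a b
    proof -
      have e: "(cbox (?h a) (?h b) = {}) = (cbox a b = {})"
        by (simp add: interval_eq_empty_cart) (metis transpose_involutory)
      have "(\<Prod>i\<in>UNIV. b $ ?t i - a $ ?t i) = (\<Prod>i\<in>UNIV. b $ i - a $ i)"
        by (intro prod.reindex_bij_betw[of ?t UNIV UNIV "\<lambda>i. b $ i - a $ i"]) (simp add: bij_transpose)
      then show ?thesis using e by (cases "cbox a b = {}") (simp_all add: content_cbox_cart)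
    qed
    ultimately show "?P ?h" by (intro boxes lin d) simp
  next
    fix m n :: 'n assume mn: "m \<noteq> n"
    let ?h = "\<lambda>x :: real ^ 'n. \<chi> i. if i = m then x $ m + x $ n else x $ i"
    have lin: "linear ?h" by (rule linearI) (auto simp: vec_eq_iff algebra_simps)
    let ?I = "mat 1 :: real ^ 'n ^ 'n"
    have "matrix ?h = (\<chi> k. if k = m then row m ?I + 1 *s row n ?I else row k ?I)"
      by (auto simp: matrix_def mat_def row_def axis_def vec_eq_iff)
    then have d: "\<bar>det (matrix ?h)\<bar> = 1"
      by (simp add: det_row_operation[OF mn])
    have "measure lebesgue (?h ` cbox a b) = measure lebesgue (cbox a b)" for a b
    proof (cases "cbox a b = {}")
      case False
      have tr: "cbox a b = (+) a ` cbox 0 (b - a)" using cbox_translation[of a 0 "b - a"] by simp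
      then have ne: "cbox 0 (b - a) \<noteq> {}" using False by auto
      have "?h ` cbox a b = (+) (?h a) ` ?h ` cbox 0 (b - a)"
        unfolding tr image_image by (rule image_cong) (simp_all add: linear_add[OF lin])
      then show ?thesis
        using measure_shear_interval[OF mn ne] by (simp add: tr measure_translation)
    qed simp
    then show "?P ?h" by (intro boxes lin d)
  qed
  then show "f ` S \<in> lmeasurable" "measure lebesgue (f ` S) = \<bar>det (matrix f)\<bar> * measure lebesgue S"
    using assms(2) by blast+
qed

section \<open>Caps of convex bodies\<close>

text \<open>\<open>D r t\<close> consists of the points \<open>y\<close> of \<open>r C\<close> with
  \<open>t \<le> a \<bullet> y\<close>, and \<open>D 1 0\<close> is \<open>C\<close> itself. Since
  \<open>r C + C = (r + 1) C\<close> for convex \<open>C\<close>, midpoints of \<open>D r t\<close>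
  and \<open>C\<close> lie in \<open>D ((r + 1) / 2) (t / 2)\<close>.\<close>

lemma scaled_caps_midpoint:
  fixes C :: "'a::euclidean_space set" and a :: 'a
  assumes C: "compact C" "convex C" and "0 < r"
  defines "D \<equiv> \<lambda>r t. (\<lambda>x. r *\<^sub>R x) ` {x \<in> C. t \<le> r * (a \<bullet> x)}"
  assumes nonneg: "\<And>x. x \<in> C \<Longrightarrow> 0 \<le> a \<bullet> x"
  shows "measure lebesgue (D r t) * measure lebesgue C \<le> (measure lebesgue (D ((r + 1) / 2) (t / 2)))\<^sup>2"
proof -
  have comp: "compact (D r t)" for r t
  proof -
    have "{x \<in> C. t \<le> r * (a \<bullet> x)} = C \<inter> {x. (r *\<^sub>R a) \<bullet> x \<ge> t}" by auto
    moreover have "closed {x. (r *\<^sub>R a) \<bullet> x \<ge> t}" by (rule closed_halfspace_ge)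
    ultimately show ?thesis
      unfolding D_def using C(1) by (auto intro!: compact_scaling compact_Int_closed)
  qed
  show ?thesis
  proof (rule measure_midpoints_le[OF comp C(1) comp])
    fix x y assume "x \<in> D r t" and y: "y \<in> C"
    then obtain z where z: "x = r *\<^sub>R z" "z \<in> C" "t \<le> r * (a \<bullet> z)" by (auto simp: D_def)
    define w where "w = (r / (r + 1)) *\<^sub>R z + (1 / (r + 1)) *\<^sub>R y"
    have "w \<in> C"
      unfolding w_def using \<open>0 < r\<close> by (intro convexD[OF C(2) z(2) y]) (simp_all add: field_simps)
    moreover have w: "((r + 1) / 2) *\<^sub>R w = (1/2) *\<^sub>R (x + y)"
      
    proof -
      have "(r + 1) / 2 * (r / (r + 1)) = r / 2" "(r + 1) / 2 * (1 / (r + 1)) = 1 / 2"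
        using \<open>0 < r\<close> by (simp_all add: divide_simps)
      then show ?thesis by (simp only: w_def z(1) scaleR_add_right scaleR_scaleR) simp
    qed
    moreover have "t / 2 \<le> (r + 1) / 2 * (a \<bullet> w)"
    proof -
      have "(r + 1) / 2 * (a \<bullet> w) = a \<bullet> (((r + 1) / 2) *\<^sub>R w)" by simp
      also have "\<dots> = (r * (a \<bullet> z) + a \<bullet> y) / 2" unfolding w z(1) by (simp add: inner_add_right)
      finally show ?thesis using z(3) nonneg[OF y] by simp
    qed
    ultimately show "(1/2) *\<^sub>R (x + y) \<in> D ((r + 1) / 2) (t / 2)"
      unfolding D_def by (intro image_eqI[of _ _ w]) auto
  qed
qed

text \<open>Halving the parameters repeatedly turns the midpoint inequality into the tangent inequality
  of a log-concave function at \<open>(1, 0)\<close>.\<close>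

lemma cap_decay_exp:
  fixes C :: "'a::euclidean_space set" and a :: 'a and V \<tau> r t :: real
  assumes C: "compact C" "convex C" and nonneg: "\<And>x. x \<in> C \<Longrightarrow> 0 \<le> a \<bullet> x"
    and V: "V = measure lebesgue C" "0 < V" and "0 < \<tau>"
    and init: "\<And>s. 0 \<le> s \<Longrightarrow> s \<le> 1 \<Longrightarrow>
      measure lebesgue {x \<in> C. s \<le> a \<bullet> x} \<le> V - \<tau> * (1 - (1 - s) ^ DIM('a))"
    and r: "0 < r" and t: "0 \<le> t"
  shows "r ^ DIM('a) * measure lebesgue {x \<in> C. t \<le> r * (a \<bullet> x)}
    \<le> V * exp (DIM('a) * (r - 1) - DIM('a) * (\<tau> * t / V))"
proof -
  let ?n = "DIM('a)"
  define D where "D = (\<lambda>r t. (\<lambda>x. r *\<^sub>R x) ` {x \<in> C. t \<le> r * (a \<bullet> x)})"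
  \<comment> \<open>After \<open>k\<close> halvings the parameters \<open>(r, t)\<close> have moved
    to \<open>(rr k, tt k)\<close>, which tends to \<open>(1, 0)\<close>, where \<open>init\<close>
    applies. Each halving costs one squaring of the normalised volume \<open>q\<close>.\<close>
  define rr where "rr k = 1 + (r - 1) / 2 ^ k" for k :: nat
  define tt where "tt k = t / 2 ^ k" for k :: nat
  define q where "q k = measure lebesgue (D (rr k) (tt k)) / V" for k
  have rr: "0 < rr k" for k
  proof -
    have "1 / 2 ^ k \<le> (1::real)" by simp
    then have "rr k = (1 - 1 / 2 ^ k) + r / 2 ^ k" "0 \<le> 1 - 1 / (2::real) ^ k" by (auto simp: rr_def diff_divide_distrib)
    moreover have "0 < r / 2 ^ k" using r by simp
    ultimately show ?thesis by linarith
  qed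
  have q0: "0 \<le> q k" for k using V by (simp add: q_def)
  have step: "q k \<le> (q (Suc k))\<^sup>2" for k
  proof -
    have e: "(rr k + 1) / 2 = rr (Suc k)" "tt k / 2 = tt (Suc k)" by (simp_all add: rr_def tt_def field_simps)
    have "measure lebesgue (D (rr k) (tt k)) * V \<le> (measure lebesgue (D (rr (Suc k)) (tt (Suc k))))\<^sup>2"
      using scaled_caps_midpoint[OF C rr nonneg, of k "tt k"] by (simp add: D_def V(1) e)
    then show ?thesis using V(2) by (simp add: q_def power2_eq_square field_simps)
  qed
  have pow: "q 0 \<le> q k ^ (2 ^ k)" for k
  proof (induction k)
    case (Suc k)
    have "q k ^ (2 ^ k) \<le> ((q (Suc k))\<^sup>2) ^ (2 ^ k)" by (intro power_mono step q0)
    then show ?case using Suc by (simp add: power_mult)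
  qed simp
  have lim_rr: "rr \<longlonglongrightarrow> 1"
  proof -
    have "(\<lambda>k. 1 + (r - 1) * (1/2) ^ k) \<longlonglongrightarrow> 1 + (r - 1) * 0"
      by (intro tendsto_intros LIMSEQ_realpow_zero) auto
    then show ?thesis by (simp add: rr_def[abs_def] power_divide)
  qed
  have lim_tt: "tt \<longlonglongrightarrow> 0"
  proof -
    have "(\<lambda>k. t * (1/2) ^ k) \<longlonglongrightarrow> t * 0"
      by (intro tendsto_intros LIMSEQ_realpow_zero) auto
    then show ?thesis by (simp add: tt_def[abs_def] power_divide)
  qed
  define \<sigma> where "\<sigma> k = tt k / rr k" for k
  have lim_sig: "\<sigma> \<longlonglongrightarrow> 0"
    using tendsto_divide[OF lim_tt lim_rr] by (simp add: \<sigma>_def[abs_def])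
  \<comment> \<open>\<open>X k\<close> equals \<open>2 ^ k * (1 - (1 - \<sigma> k) ^ ?n)\<close>;
    the factored form exhibits its limit \<open>?n * t\<close>.\<close>
  define X where "X k = (t / rr k) * (\<Sum>i<?n. (1 - \<sigma> k) ^ i)" for k
  have "X \<longlonglongrightarrow> (t / 1) * (\<Sum>i<?n. (1 - 0) ^ i)"
    unfolding X_def[abs_def] by (intro tendsto_intros lim_rr lim_sig) simp
  then have lim_X: "X \<longlonglongrightarrow> ?n * t" by (simp add: mult.commute)
  have bound: "q 0 \<le> exp (?n * (r - 1) - \<tau> / V * X k)" if small: "\<sigma> k \<le> 1" for k
  proof -
    have s0: "0 \<le> \<sigma> k" using t rr[of k] by (simp add: \<sigma>_def tt_def)
    have X: "1 - (1 - \<sigma> k) ^ ?n = X k / 2 ^ k"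
      using one_diff_power_eq[of "1 - \<sigma> k" ?n] by (simp add: X_def \<sigma>_def tt_def)
    have cap: "{x \<in> C. tt k \<le> rr k * (a \<bullet> x)} = {x \<in> C. \<sigma> k \<le> a \<bullet> x}"
      using rr[of k] by (auto simp: \<sigma>_def field_simps)
    have "measure lebesgue (D (rr k) (tt k)) = rr k ^ ?n * measure lebesgue {x \<in> C. \<sigma> k \<le> a \<bullet> x}"
      using measure_lebesgue_affine[of "rr k" 0 "{x \<in> C. tt k \<le> rr k * (a \<bullet> x)}"] rr[of k]
      by (simp add: D_def cap)
    also have "\<dots> \<le> rr k ^ ?n * (V - \<tau> * (1 - (1 - \<sigma> k) ^ ?n))"
      using rr[of k] by (intro mult_left_mono init s0 small) simp
    finally have "q k \<le> rr k ^ ?n * (1 - \<tau> / V * (X k / 2 ^ k))"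
      using V(2) unfolding X by (simp add: q_def field_simps)
    \<comment> \<open>Bounding both factors by \<open>1 + u \<le> exp u\<close> makes the power
      \<open>2 ^ k\<close> explicit.\<close>
    also have "\<dots> \<le> rr k ^ ?n * exp (- (\<tau> / V * (X k / 2 ^ k)))"
      using rr[of k] exp_ge_add_one_self[of "- (\<tau> / V * (X k / 2 ^ k))"] by (intro mult_left_mono) auto
    also have "\<dots> \<le> exp ((r - 1) / 2 ^ k) ^ ?n * exp (- (\<tau> / V * (X k / 2 ^ k)))"
      using rr[of k] exp_ge_add_one_self[of "(r - 1) / 2 ^ k"]
      by (intro mult_right_mono power_mono) (auto simp: rr_def)
    also have "\<dots> = exp ((?n * (r - 1) - \<tau> / V * X k) / 2 ^ k)"
      by (simp add: exp_of_nat_mult[symmetric] exp_add[symmetric] field_simps)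
    finally have "q k ^ (2 ^ k) \<le> exp ((?n * (r - 1) - \<tau> / V * X k) / 2 ^ k) ^ (2 ^ k)"
      by (intro power_mono q0)
    also have "\<dots> = exp (?n * (r - 1) - \<tau> / V * X k)"
      by (simp add: exp_of_nat_mult[symmetric])
    finally show ?thesis using pow[of k] by simp
  qed
  have "eventually (\<lambda>k. \<sigma> k < 1) sequentially"
    using lim_sig by (rule order_tendstoD) simp
  then have ev: "eventually (\<lambda>k. q 0 \<le> exp (?n * (r - 1) - \<tau> / V * X k)) sequentially"
    by eventually_elim (rule bound, simp)
  have "(\<lambda>k. exp (?n * (r - 1) - \<tau> / V * X k)) \<longlonglongrightarrow> exp (?n * (r - 1) - \<tau> / V * (?n * t))"
    by (intro tendsto_intros lim_X)
  then have "q 0 \<le> exp (?n * (r - 1) - \<tau> / V * (?n * t))"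
    using tendsto_lowerbound[OF _ ev] by simp
  moreover have "q 0 = r ^ ?n * measure lebesgue {x \<in> C. t \<le> r * (a \<bullet> x)} / V"
    using measure_lebesgue_affine[of r 0 "{x \<in> C. t \<le> r * (a \<bullet> x)}"] r
    by (simp add: q_def D_def rr_def tt_def)
  ultimately show ?thesis
    using V(2) by (simp add: pos_divide_le_eq mult_ac)
qed

text \<open>Scaling the cap by \<open>r\<close> and taking \<open>t = r * s\<close> in
  \<open>cap_decay_exp\<close> leaves \<open>r\<close> free. With \<open>c = \<tau> * s / V\<close>
  below 1, the choice \<open>r = 1 / (1 - c)\<close> makes the exponent vanish and leaves
  \<open>(1 - c) ^ n\<close>; for \<open>c \<ge> 1\<close>, large \<open>r\<close> forces the cap to
  have volume 0.\<close>

lemma cap_decay: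
  fixes C :: "'a::euclidean_space set" and a :: 'a and V \<tau> s :: real
  assumes C: "compact C" "convex C" and nonneg: "\<And>x. x \<in> C \<Longrightarrow> 0 \<le> a \<bullet> x"
    and V: "V = measure lebesgue C" "0 < V" and \<tau>: "0 < \<tau>"
    and init: "\<And>s. 0 \<le> s \<Longrightarrow> s \<le> 1 \<Longrightarrow>
      measure lebesgue {x \<in> C. s \<le> a \<bullet> x} \<le> V - \<tau> * (1 - (1 - s) ^ DIM('a))"
    and s: "0 \<le> s"
  shows "measure lebesgue {x \<in> C. s \<le> a \<bullet> x} \<le> V * (max 0 (1 - \<tau> * s / V)) ^ DIM('a)"
proof -
  let ?n = "DIM('a)"
  define \<Phi> where "\<Phi> = measure lebesgue {x \<in> C. s \<le> a \<bullet> x}"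
  define c where "c = \<tau> * s / V"
  have bd: "\<Phi> \<le> V * (exp (r * (1 - c) - 1) / r) ^ ?n" if r: "0 < r" for r
  proof -
    have "{x \<in> C. r * s \<le> r * (a \<bullet> x)} = {x \<in> C. s \<le> a \<bullet> x}" using r by auto
    then have "r ^ ?n * \<Phi> \<le> V * exp (?n * (r - 1) - ?n * (\<tau> * (r * s) / V))"
      using cap_decay_exp[OF C nonneg V \<tau> init r, of "r * s"] r s by (simp add: \<Phi>_def)
    also have "?n * (r - 1) - ?n * (\<tau> * (r * s) / V) = ?n * (r * (1 - c) - 1)"
      by (simp add: c_def algebra_simps)
    also have "exp (?n * (r * (1 - c) - 1)) = exp (r * (1 - c) - 1) ^ ?n" by (rule exp_of_nat_mult)
    finally show ?thesis using r by (simp add: power_divide field_simps)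
  qed
  show ?thesis
  proof (cases "c < 1")
    case True
    then show ?thesis using bd[of "1 / (1 - c)"] by (simp add: \<Phi>_def c_def[symmetric])
  next
    case False
    have "\<Phi> \<le> 0"
    proof (rule ccontr)
      assume pos: "\<not> \<Phi> \<le> 0"
      \<comment> \<open>Large enough that the resulting bound \<open>V / r\<close> is at most
        \<open>\<Phi> / 2\<close>.\<close>
      define r where "r = max 1 (2 * V / \<Phi>)"
      have r: "1 \<le> r" "2 * V / \<Phi> \<le> r" by (auto simp: r_def)
      have "r * (1 - c) \<le> 0" using False r(1) by (intro mult_nonneg_nonpos) auto
      then have "exp (r * (1 - c) - 1) \<le> 1" by simp
      then have "exp (r * (1 - c) - 1) / r \<le> 1 / r" using r by (intro divide_right_mono) auto
      then have "(exp (r * (1 - c) - 1) / r) ^ ?n \<le> (1 / r) ^ ?n" using r by (intro power_mono) auto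
      also have "\<dots> \<le> (1 / r) ^ 1" using r by (intro power_decreasing) (auto simp: Suc_le_eq)
      finally have "V * (exp (r * (1 - c) - 1) / r) ^ ?n \<le> V * (1 / r)"
        using V(2) by (intro mult_left_mono) auto
      then have "\<Phi> \<le> V / r" using bd[of r] r by simp
      then have "\<Phi> * r \<le> V" using r by (simp add: field_simps)
      moreover have "2 * V \<le> \<Phi> * r" using r(2) pos by (simp add: field_simps)
      ultimately show False using V(2) by linarith
    qed
    moreover have "max 0 (1 - c) = 0" using False by simp
    ultimately show ?thesis unfolding \<Phi>_def[symmetric] c_def[symmetric] by (simp add: power_0_left)
  qed
qed

text \<open>\<open>?F\<close> is an antiderivative on \<open>{0..V / \<tau>}\<close>; beyond this
  interval the base of the power is 0, and the exponent is positive.\<close>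

lemma nn_integral_max_power:
  assumes "0 < V" "0 < \<tau>" and n: "0 < n"
  shows "(\<integral>\<^sup>+t. (if 0 \<le> t then ennreal (V * (max 0 (1 - \<tau> * t / V)) ^ n) else 0) \<partial>lborel)
    \<le> ennreal (V\<^sup>2 / (\<tau> * real (n + 1)))"
proof -
  let ?F = "\<lambda>t. - (V\<^sup>2 / (\<tau> * real (n + 1))) * (1 - \<tau> * t / V) ^ (n + 1)"
  have "(\<integral>\<^sup>+t. (if 0 \<le> t then ennreal (V * (max 0 (1 - \<tau> * t / V)) ^ n) else 0) \<partial>lborel)
      = (\<integral>\<^sup>+t. ennreal (V * (1 - \<tau> * t / V) ^ n) * indicator {0..V / \<tau>} t \<partial>lborel)"
  proof (rule nn_integral_cong)
    fix t :: real
    have "t \<le> V / \<tau> \<longleftrightarrow> 0 \<le> 1 - \<tau> * t / V" using assms by (simp add: field_simps)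
    then show "(if 0 \<le> t then ennreal (V * (max 0 (1 - \<tau> * t / V)) ^ n) else 0)
        = ennreal (V * (1 - \<tau> * t / V) ^ n) * indicator {0..V / \<tau>} t"
      using n by (auto simp: indicator_def max_def power_0_left)
  qed
  also have "\<dots> = ennreal (?F (V / \<tau>) - ?F 0)"
  proof (rule nn_integral_FTC_Icc)
    fix t assume "t \<in> {0..V / \<tau>}"
    then have t: "0 \<le> t" "t \<le> V / \<tau>" by auto
    have "((\<lambda>t. 1 - \<tau> * t / V) has_real_derivative - (\<tau> / V)) (at t)"
      using assms(1) by (auto intro!: derivative_eq_intros)
    from DERIV_cmult[OF DERIV_power[OF this, of "n + 1"], of "- (V\<^sup>2 / (\<tau> * real (n + 1)))"]
    have "(?F has_real_derivative - (V\<^sup>2 / (\<tau> * real (n + 1)))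
        * (real (n + 1) * (- (\<tau> / V) * (1 - \<tau> * t / V) ^ n))) (at t)"
      by simp
    also have "- (V\<^sup>2 / (\<tau> * real (n + 1))) * (real (n + 1) * (- (\<tau> / V) * (1 - \<tau> * t / V) ^ n))
        = V * (1 - \<tau> * t / V) ^ n"
    proof -
      have "V \<noteq> 0" "\<tau> \<noteq> 0" "real (n + 1) \<noteq> 0" using assms by auto
      then show ?thesis by (simp add: power2_eq_square divide_simps)
    qed
    finally show "(?F has_real_derivative V * (1 - \<tau> * t / V) ^ n) (at t)" .
    have "0 \<le> 1 - \<tau> * t / V" using t assms by (simp add: field_simps)
    then show "0 \<le> V * (1 - \<tau> * t / V) ^ n" using assms by simp
  qed (use assms in auto)
  also have "?F (V / \<tau>) - ?F 0 = V\<^sup>2 / (\<tau> * real (n + 1))" using assms by simp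
  finally show ?thesis by simp
qed

text \<open>The layer-cake formula writes the moment as an integral of cap volumes, which
  \<open>cap_decay\<close> bounds.\<close>

lemma cap_moment:
  fixes C :: "'a::euclidean_space set" and a :: 'a and V \<tau> :: real
  assumes C: "compact C" "convex C" and nonneg: "\<And>x. x \<in> C \<Longrightarrow> 0 \<le> a \<bullet> x"
    and V: "V = measure lebesgue C" "0 < V" and \<tau>: "0 < \<tau>"
    and init: "\<And>s. 0 \<le> s \<Longrightarrow> s \<le> 1 \<Longrightarrow>
      measure lebesgue {x \<in> C. s \<le> a \<bullet> x} \<le> V - \<tau> * (1 - (1 - s) ^ DIM('a))"
  shows "(\<integral>\<^sup>+x. ennreal (a \<bullet> x) * indicator C x \<partial>lborel) \<le> ennreal (V\<^sup>2 / (\<tau> * real (DIM('a) + 1)))"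
proof -
  have [measurable]: "C \<in> sets borel" using C(1) by (rule borel_compact)
  have "(\<integral>\<^sup>+x. ennreal (a \<bullet> x) * indicator C x \<partial>lborel)
      = (\<integral>\<^sup>+t. (if 0 \<le> t then emeasure lborel {x. ennreal t < ennreal (a \<bullet> x) * indicator C x} else 0) \<partial>lborel)"
    by (rule nn_integral_layer_cake) measurable
  also have "\<dots> \<le> (\<integral>\<^sup>+t. (if 0 \<le> t then ennreal (V * (max 0 (1 - \<tau> * t / V)) ^ DIM('a)) else 0) \<partial>lborel)"
  proof (rule nn_integral_mono)
    fix t :: real
    have "emeasure lborel {x. ennreal t < ennreal (a \<bullet> x) * indicator C x} \<le> ennreal (V * (max 0 (1 - \<tau> * t / V)) ^ DIM('a))"
      if t: "0 \<le> t"
    proof -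
      have eq: "{x \<in> C. t \<le> a \<bullet> x} = C \<inter> {x. a \<bullet> x \<ge> t}" by auto
      have comp: "compact {x \<in> C. t \<le> a \<bullet> x}"
        unfolding eq by (intro compact_Int_closed C closed_halfspace_ge)
      have "emeasure lborel {x. ennreal t < ennreal (a \<bullet> x) * indicator C x} \<le> emeasure lborel {x \<in> C. t \<le> a \<bullet> x}"
        using t by (intro emeasure_mono) (auto simp: indicator_def ennreal_less_iff split: if_splits
          intro: borel_compact[OF comp])
      also have "\<dots> = ennreal (measure lebesgue {x \<in> C. t \<le> a \<bullet> x})"
        using emeasure_compact_finite[OF comp] borel_compact[OF comp]
        by (simp add: emeasure_eq_ennreal_measure)
      also have "\<dots> \<le> ennreal (V * (max 0 (1 - \<tau> * t / V)) ^ DIM('a))"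
        by (intro ennreal_leI cap_decay[OF C nonneg V \<tau> init t])
      finally show ?thesis .
    qed
    then show "(if 0 \<le> t then emeasure lborel {x. ennreal t < ennreal (a \<bullet> x) * indicator C x} else 0)
        \<le> (if 0 \<le> t then ennreal (V * (max 0 (1 - \<tau> * t / V)) ^ DIM('a)) else 0)" by simp
  qed
  also have "\<dots> \<le> ennreal (V\<^sup>2 / (\<tau> * real (DIM('a) + 1)))"
    by (rule nn_integral_max_power[OF V(2) \<tau>]) simp
  finally show ?thesis .
qed


section \<open>Simplices in bodies with centroid 0\<close>

text \<open>Every point of \<open>T\<close> is \<open>v p\<close> with
  \<open>0 \<le> v \<le> 1\<close> and \<open>p\<close> in the convex hull of \<open>P\<close>,
  where \<open>b \<bullet> p = 1\<close>. In the cap \<open>v \<le> 1 - s\<close>, so the cap lies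
  in the homothetic copy \<open>(1 - s) T\<close>.\<close>

lemma measure_simplex_cap:
  fixes P :: "'a::euclidean_space set"
  assumes P: "finite P" "P \<noteq> {}" and b: "\<And>p. p \<in> P \<Longrightarrow> b \<bullet> p = 1"
    and s: "0 \<le> s" "s \<le> 1"
  defines "T \<equiv> convex hull (insert 0 P)"
  shows "measure lebesgue (T \<inter> {x. s \<le> 1 - b \<bullet> x}) \<le> (1 - s) ^ DIM('a) * measure lebesgue T"
proof -
  have cT: "compact T" unfolding T_def using P by (intro finite_imp_compact_convex_hull) auto
  have hull1: "b \<bullet> x = 1" if "x \<in> convex hull P" for x
  proof -
    have "convex hull P \<subseteq> {x. b \<bullet> x = 1}"
      using b by (intro hull_minimal convex_hyperplane) auto
    then show ?thesis using that by auto
  qed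
  have "T \<inter> {x. s \<le> 1 - b \<bullet> x} \<subseteq> (\<lambda>x. (1 - s) *\<^sub>R x + 0) ` T"
  proof
    fix x assume x: "x \<in> T \<inter> {x. s \<le> 1 - b \<bullet> x}"
    then obtain v p where vp: "0 \<le> v" "p \<in> convex hull P" "x = v *\<^sub>R p"
      unfolding T_def using P(2) by (auto simp: convex_hull_insert)
    then have v: "v \<le> 1 - s" using x hull1[of p] by simp
    show "x \<in> (\<lambda>x. (1 - s) *\<^sub>R x + 0) ` T"
    proof (cases "s = 1")
      case True
      then have "x = 0" using v vp by simp
      then show ?thesis using True by (auto simp: T_def intro!: image_eqI[of _ _ 0] hull_inc)
    next
      case False
      then have s1: "0 < 1 - s" using s by simp
      have "p \<in> T" using vp(2) unfolding T_def by (meson hull_mono subsetD subset_insertI)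
      have "0 \<in> T" unfolding T_def by (simp add: hull_inc)
      have "(1 - v / (1 - s)) *\<^sub>R 0 + (v / (1 - s)) *\<^sub>R p \<in> T"
      proof -
        have "0 \<le> v / (1 - s)" "v / (1 - s) \<le> 1" using v vp(1) s1 by simp_all
        moreover have "convex T" unfolding T_def by (rule convex_convex_hull)
        ultimately show ?thesis using \<open>p \<in> T\<close> \<open>0 \<in> T\<close> by (intro convexD) auto
      qed
      then have "(v / (1 - s)) *\<^sub>R p \<in> T" by simp
      then show ?thesis using s1 vp(3) by (intro image_eqI[of _ _ "(v / (1 - s)) *\<^sub>R p"]) auto
    qed
  qed
  moreover have m: "(\<lambda>x. (1 - s) *\<^sub>R x + 0) ` T \<in> lmeasurable"
    using cT by (intro lmeasurable_compact) (auto intro!: compact_scaling)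
  moreover have "T \<inter> {x. s \<le> 1 - b \<bullet> x} \<in> lmeasurable"
  proof -
    have eq: "{x. s \<le> 1 - b \<bullet> x} = {x. b \<bullet> x \<le> 1 - s}" by auto
    show ?thesis unfolding eq by (intro lmeasurable_compact compact_Int_closed cT closed_halfspace_le)
  qed
  ultimately have "measure lebesgue (T \<inter> {x. s \<le> 1 - b \<bullet> x}) \<le> measure lebesgue ((\<lambda>x. (1 - s) *\<^sub>R x + 0) ` T)"
    by (intro measure_mono_fmeasurable) (auto simp: fmeasurableD)
  also have "\<dots> = (1 - s) ^ DIM('a) * measure lebesgue T"
    using measure_lebesgue_affine[of "1 - s" 0 T] s by simp
  finally show ?thesis .
qed

text \<open>The linear part integrates to 0 because the first moment of \<open>K\<close> vanishes.
  The case \<open>c = 1\<close> yields the integral of the affine function of the simplex argument,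
  the case \<open>c = 0\<close> that of a linear functional.\<close>

lemma lebesgue_integral_zero_imp_affine:
  fixes K :: "'a::euclidean_space set"
  assumes K: "compact K" and zero: "(LINT x:K|lebesgue. x) = 0"
  shows "(LINT x|lborel. indicator K x * (c - b \<bullet> x)) = c * measure lebesgue K"
    and "integrable lborel (\<lambda>x. indicator K x * (c - b \<bullet> x))"
proof -
  have [measurable]: "K \<in> sets borel" using K by (rule borel_compact)
  have intx: "integrable lborel (\<lambda>x. indicator K x *\<^sub>R x)"
    by (rule borel_integrable_compact[OF K]) (rule continuous_on_id)
  have int1: "integrable lborel (indicator K :: 'a \<Rightarrow> real)"
    using emeasure_compact_finite[OF K] by (intro integrable_real_indicator) auto
  have "(LINT x|lborel. indicator K x *\<^sub>R x) = (LINT x:K|lebesgue. x)"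
    unfolding set_lebesgue_integral_def by (rule integral_completion[symmetric]) measurable
  then have 0: "(LINT x|lborel. indicator K x *\<^sub>R x) = 0" using zero by simp
  have eq: "indicator K x * (c - b \<bullet> x) = c * indicator K x - b \<bullet> (indicator K x *\<^sub>R x)" for x
    by (simp add: algebra_simps)
  show "integrable lborel (\<lambda>x. indicator K x * (c - b \<bullet> x))"
    unfolding eq using intx int1 by (intro Bochner_Integration.integrable_diff integrable_mult_right integrable_inner_right) auto
  have "(LINT x|lborel. indicator K x * (c - b \<bullet> x))
      = c * (LINT x|lborel. indicator K x) - b \<bullet> (LINT x|lborel. indicator K x *\<^sub>R x)"
    unfolding eq using intx int1
    by (subst Bochner_Integration.integral_diff)
      (auto simp del: inner_scaleR_right intro: integrable_inner_right)
  also have "\<dots> = c * measure lebesgue K" using 0 by simp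
  finally show "(LINT x|lborel. indicator K x * (c - b \<bullet> x)) = c * measure lebesgue K" .
qed

text \<open>For \<open>h x = 1 - b \<bullet> x\<close>, the integral over \<open>K\<close> is the
  volume of \<open>K\<close> and at most the integral over \<open>K'\<close>, the part with
  \<open>h \<ge> 0\<close>. A vertex \<open>p\<close> with \<open>h p = 0\<close> is moved to the
  origin, which makes \<open>h\<close> linear, so that \<open>cap_moment\<close> applies.\<close>

theorem measure_ge_simplex_of_centroid:
  fixes K P :: "'a::euclidean_space set"
  assumes K: "compact K" "convex K" and zero: "(LINT x:K|lebesgue. x) = 0"
    and P: "finite P" "P \<noteq> {}" "\<And>p. p \<in> P \<Longrightarrow> b \<bullet> p = 1" and sub: "insert 0 P \<subseteq> K"
  shows "real (DIM('a) + 1) * measure lebesgue (convex hull (insert 0 P)) \<le> measure lebesgue K"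
proof (cases "measure lebesgue (convex hull (insert 0 P)) = 0")
  case False
  define T where "T = convex hull (insert 0 P)"
  define \<tau> where "\<tau> = measure lebesgue T"
  have \<tau>: "0 < \<tau>" using False by (simp add: \<tau>_def T_def zero_less_measure_iff)
  obtain p where p: "p \<in> P" using P by blast
  define K' where "K' = K \<inter> {x. b \<bullet> x \<le> 1}"
  have K': "compact K'" "convex K'"
    unfolding K'_def by (auto intro!: compact_Int_closed K closed_halfspace_le convex_Int convex_halfspace_le)
  have T: "compact T" unfolding T_def using P by (intro finite_imp_compact_convex_hull) auto
  have TK: "T \<subseteq> K'"
    unfolding T_def by (intro hull_minimal K') (use sub P(3) in \<open>auto simp: K'_def\<close>)
  define V where "V = measure lebesgue K'"
  have "\<tau> \<le> V" unfolding \<tau>_def V_def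
    using TK T K' by (intro measure_mono_fmeasurable) (auto intro: lmeasurable_compact fmeasurableD)
  then have V: "0 < V" using \<tau> by linarith
  have VK: "V \<le> measure lebesgue K" unfolding V_def
    using K K' by (intro measure_mono_fmeasurable) (auto simp: K'_def intro: lmeasurable_compact fmeasurableD)
  define C where "C = (+) (- p) ` K'"
  have C: "compact C" "convex C"
    unfolding C_def using K' by (intro compact_translation convex_translation; simp)+
  have bp: "b \<bullet> p = 1" using P p by simp
  have hC: "(- b) \<bullet> (- p + x) = 1 - b \<bullet> x" for x
    using bp by (simp add: inner_diff_right)
  have capC: "{y \<in> C. s \<le> (- b) \<bullet> y} = (+) (- p) ` (K' \<inter> {x. s \<le> 1 - b \<bullet> x})" for s
    unfolding C_def using hC by (auto simp del: inner_minus_left)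
  \<comment> \<open>Passing from \<open>K'\<close> to the cap removes at least the part of
    \<open>T\<close> outside the cap, whose volume \<open>measure_simplex_cap\<close> bounds from
    below.\<close>
  have init: "measure lebesgue {y \<in> C. s \<le> (- b) \<bullet> y} \<le> V - \<tau> * (1 - (1 - s) ^ DIM('a))"
    if s: "0 \<le> s" "s \<le> 1" for s
  proof -
    have eq: "{x. s \<le> 1 - b \<bullet> x} = {x. b \<bullet> x \<le> 1 - s}" by auto
    let ?H = "{x. s \<le> 1 - b \<bullet> x}"
    have cl: "closed ?H" unfolding eq by (rule closed_halfspace_le)
    have mH: "K' \<inter> ?H \<in> lmeasurable" "T \<inter> ?H \<in> lmeasurable" "T \<in> lmeasurable" "K' \<in> lmeasurable"
      using cl K' T by (auto intro: lmeasurable_compact compact_Int_closed)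
    have "measure lebesgue (T - T \<inter> ?H) = \<tau> - measure lebesgue (T \<inter> ?H)"
      unfolding \<tau>_def using mH by (intro measurable_measure_Diff) (auto simp: fmeasurableD)
    also have "\<dots> \<ge> \<tau> - (1 - s) ^ DIM('a) * \<tau>"
      using measure_simplex_cap[OF P s] by (simp add: T_def \<tau>_def)
    finally have 1: "\<tau> - (1 - s) ^ DIM('a) * \<tau> \<le> measure lebesgue (T - T \<inter> ?H)" .
    have "measure lebesgue (T - T \<inter> ?H) + measure lebesgue (K' \<inter> ?H)
        = measure lebesgue ((T - T \<inter> ?H) \<union> (K' \<inter> ?H))"
    proof (rule measure_Union[symmetric])
      show "emeasure lebesgue (T - T \<inter> ?H) \<noteq> \<infinity>" "emeasure lebesgue (K' \<inter> ?H) \<noteq> \<infinity>"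
        using fmeasurableD2[OF fmeasurable.Diff[OF mH(3,2)]] fmeasurableD2[OF mH(1)] by auto
    qed (use mH in \<open>auto simp: fmeasurableD\<close>)
    also have "\<dots> \<le> V" unfolding V_def
      using mH TK by (intro measure_mono_fmeasurable) (auto simp: fmeasurableD)
    finally have "measure lebesgue (K' \<inter> ?H) \<le> V - \<tau> * (1 - (1 - s) ^ DIM('a))"
      using 1 by (simp add: algebra_simps)
    then show ?thesis unfolding capC by (simp only: measure_translation)
  qed
  have mC: "V = measure lebesgue C" by (simp only: C_def V_def measure_translation)
  have nonneg: "0 \<le> (- b) \<bullet> y" if "y \<in> C" for y
    using that hC by (auto simp: C_def K'_def simp del: inner_minus_left)
  have [measurable]: "C \<in> sets borel" "K \<in> sets borel" "K' \<in> sets borel"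
    using C K K' by (auto intro: borel_compact)
  \<comment> \<open>Only the positive part of the integrand is kept; it is supported on
    \<open>K'\<close>.\<close>
  have "(LINT x|lborel. indicator K x * (1 - b \<bullet> x)) \<le> enn2real (\<integral>\<^sup>+x. ennreal (indicator K x * (1 - b \<bullet> x)) \<partial>lborel)"
  proof -
    have int: "integrable lborel (\<lambda>x. indicator K x * (1 - b \<bullet> x))"
      by (rule lebesgue_integral_zero_imp_affine(2)[OF K(1) zero])
    show ?thesis by (subst real_lebesgue_integral_def[OF int]) simp
  qed
  also have "(\<integral>\<^sup>+x. ennreal (indicator K x * (1 - b \<bullet> x)) \<partial>lborel)
      = (\<integral>\<^sup>+x. ennreal ((- b) \<bullet> (- p + x)) * indicator C (- p + x) \<partial>lborel)"
  proof (rule nn_integral_cong)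
    fix x
    have "indicator C (- p + x) = (indicator K' x :: ennreal)" by (auto simp: C_def indicator_def)
    then show "ennreal (indicator K x * (1 - b \<bullet> x)) = ennreal ((- b) \<bullet> (- p + x)) * indicator C (- p + x)"
      unfolding hC by (auto simp: K'_def indicator_def ennreal_neg)
  qed
  also have "\<dots> = (\<integral>\<^sup>+y. ennreal ((- b) \<bullet> y) * indicator C y \<partial>distr lborel borel ((+) (- p)))"
    by (subst nn_integral_distr) auto
  also have "\<dots> = (\<integral>\<^sup>+y. ennreal ((- b) \<bullet> y) * indicator C y \<partial>lborel)"
    by (simp add: lborel_distr_plus)
  finally have "(LINT x|lborel. indicator K x * (1 - b \<bullet> x))
      \<le> enn2real (\<integral>\<^sup>+y. ennreal ((- b) \<bullet> y) * indicator C y \<partial>lborel)" .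
  also have "\<dots> \<le> enn2real (ennreal (V\<^sup>2 / (\<tau> * real (DIM('a) + 1))))"
    by (intro enn2real_mono cap_moment[OF C nonneg mC V \<tau> init]) (auto simp: less_top[symmetric])
  also have "\<dots> = V\<^sup>2 / (\<tau> * real (DIM('a) + 1))" using V \<tau> by (simp del: of_nat_add of_nat_Suc)
  finally have "measure lebesgue K \<le> V\<^sup>2 / (\<tau> * real (DIM('a) + 1))"
    using lebesgue_integral_zero_imp_affine(1)[OF K(1) zero, of 1 b] by simp
  \<comment> \<open>As \<open>V\<close> is at most the volume of \<open>K\<close>, one factor
    \<open>measure lebesgue K\<close> can be cancelled.\<close>
  then have "measure lebesgue K * (\<tau> * real (DIM('a) + 1)) \<le> V\<^sup>2"
    using \<tau> by (simp add: pos_le_divide_eq)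
  also have "\<dots> \<le> measure lebesgue K * measure lebesgue K"
    unfolding power2_eq_square using VK V by (intro mult_mono) auto
  finally show ?thesis using VK V by (simp add: \<tau>_def T_def mult.commute)
qed (auto simp: measure_nonneg)

section \<open>Lattices\<close>

lemma det_rows_replace_combination:
  fixes z :: "'n::finite \<Rightarrow> real ^ 'n"
  assumes "x \<in> span (z ` (- {k}))"
  shows "det (\<chi> i. if i = k then c *\<^sub>R z k + x else z i) = c * det (\<chi> i. z i)"
proof -
  let ?A = "\<chi> i. if i = k then c *\<^sub>R z k else z i"
  have row: "row i ?A = (if i = k then c *\<^sub>R z k else z i)" for i by (simp add: row_def vec_lambda_eta)
  have "{row j ?A |j. j \<noteq> k} = z ` (- {k})" by (auto simp: row)
  then have "x \<in> vec.span {row j ?A |j. j \<noteq> k}" using assms by (simp add: span_vec_eq)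
  from det_row_span[OF this]
  have "det (\<chi> i. if i = k then c *\<^sub>R z k + x else z i) = det ?A" by (simp add: row cong: if_cong)
  also have "\<dots> = c * det (\<chi> i. if i = k then z k else z i)"
    using det_row_mul[of k c "\<lambda>_. z k" z] by (simp add: scalar_mult_eq_scaleR cong: if_cong)
  also have "(\<chi> i. if i = k then z k else z i) = (\<chi> i. z i)" by (simp add: vec_eq_iff)
  finally show ?thesis .
qed

text \<open>Cramer's rule: the terms with \<open>j \<noteq> k\<close> are combinations of the other
  rows.\<close>

lemma det_rows_replace:
  fixes z :: "'n::finite \<Rightarrow> real ^ 'n"
  shows "det (\<chi> i. if i = k then (\<Sum>j\<in>UNIV. t j *\<^sub>R z j) else z i) = t k * det (\<chi> i. z i)"
proof -
  have "(\<Sum>j\<in>UNIV. t j *\<^sub>R z j) = t k *\<^sub>R z k + (\<Sum>j\<in>- {k}. t j *\<^sub>R z j)"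
    using sum.remove[of UNIV k "\<lambda>j. t j *\<^sub>R z j"] by (simp add: Compl_eq_Diff_UNIV)
  then show ?thesis
    by (simp only:, intro det_rows_replace_combination span_sum span_scale span_base) auto
qed

text \<open>The tuple \<open>w\<close> arises from \<open>z\<close> by an integer matrix, whose
  determinant is an integer by the Leibniz formula.\<close>

lemma det_rows_integer_combination:
  fixes z w :: "'n::finite \<Rightarrow> real ^ 'n" and A :: "'n \<Rightarrow> 'n \<Rightarrow> int"
  assumes "\<And>i. w i = (\<Sum>j\<in>UNIV. of_int (A i j) *\<^sub>R z j)"
  obtains m :: int where "det (\<chi> i. w i) = of_int m * det (\<chi> i. z i)"
proof -
  let ?M = "(\<chi> i j. of_int (A i j)) :: real ^ 'n ^ 'n"
  have "(\<chi> i. w i) = ?M ** (\<chi> i. z i)"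
    by (simp add: assms vec_eq_iff matrix_matrix_mult_def)
  then have "det (\<chi> i. w i) = det ?M * det (\<chi> i. z i)" by (simp add: det_mul)
  moreover have "det ?M \<in> \<int>"
    unfolding det_def by (intro Ints_sum Ints_mult Ints_prod) auto
  ultimately show thesis using that by (auto elim: Ints_cases)
qed

lemma det_rows_eq_0_iff:
  fixes z :: "'n::finite \<Rightarrow> real ^ 'n"
  shows "det (\<chi> i. z i) \<noteq> 0 \<longleftrightarrow> span (range z) = UNIV"
proof -
  have "rows (\<chi> i. z i) = range z" by (auto simp: rows_def row_def vec_lambda_eta)
  then show ?thesis
    by (metis invertible_det_nz invertible_left_inverse matrix_left_invertible_span_rows)
qed

lemma det_rows_nonzero_imp_independent:
  fixes z :: "'n::finite \<Rightarrow> real ^ 'n"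
  assumes "det (\<chi> i. z i) \<noteq> 0"
  shows "inj z" "independent (range z)"
proof -
  have sp: "span (range z) = UNIV" using assms det_rows_eq_0_iff by blast
  then have "CARD('n) = dim (range z)" by (metis dim_UNIV dim_span DIM_cart DIM_real mult.right_neutral)
  also have "\<dots> \<le> card (range z)" by (rule dim_le_card[OF span_superset]) simp 
  finally have c: "card (range z) = CARD('n)" using card_image_le[of UNIV z] by simp
  then show "inj z" by (intro eq_card_imp_inj_on) auto
  show "independent (range z)"
    using c sp \<open>CARD('n) = dim (range z)\<close> by (intro card_le_dim_spanning[of _ UNIV]) auto
qed

lemma det_rows_nonzero_imp_combination:
  fixes z :: "'n::finite \<Rightarrow> real ^ 'n"
  assumes "det (\<chi> i. z i) \<noteq> 0"
  obtains t where "x = (\<Sum>j\<in>UNIV. t j *\<^sub>R z j)"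
proof -
  have "x \<in> span (range z)" using assms det_rows_eq_0_iff by blast
  then obtain u where u: "x = (\<Sum>v\<in>range z. u v *\<^sub>R v)" by (auto simp: span_finite)
  also have "\<dots> = (\<Sum>j\<in>UNIV. u (z j) *\<^sub>R z j)"
    using det_rows_nonzero_imp_independent(1)[OF assms] by (simp add: sum.reindex)
  finally show thesis by (rule that)
qed

section \<open>Volumes of cells and simplices\<close>

lemma measure_combination_image:
  fixes z :: "'n::finite \<Rightarrow> real ^ 'n" and S :: "(real ^ 'n) set"
  assumes "S \<in> lmeasurable"
  shows "measure lebesgue ((\<lambda>x. \<Sum>j\<in>UNIV. x $ j *\<^sub>R z j) ` S) = \<bar>det (\<chi> i. z i)\<bar> * measure lebesgue S"
proof -
  let ?f = "\<lambda>x :: real ^ 'n. \<Sum>j\<in>UNIV. x $ j *\<^sub>R z j"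
  have lin: "linear ?f" by (rule linearI) (simp_all add: algebra_simps sum.distrib scaleR_sum_right)
  have "?f (axis j 1) = z j" for j
    by (simp add: axis_def if_distrib[of "\<lambda>c. c *\<^sub>R _"] sum.delta cong: if_cong)
  then have "matrix ?f = transpose (\<chi> i. z i)" by (simp add: matrix_def transpose_def vec_eq_iff)
  then show ?thesis using measure_lebesgue_linear_image[OF lin assms] by simp
qed

text \<open>The cell is a linear image of the half-open unit cube, whose volume is squeezed between
  those of the open and the closed cube.\<close>

lemma measure_fundamental_cell:
  fixes b :: "'n::finite \<Rightarrow> real ^ 'n"
  shows "measure lebesgue (fundamental_cell b) = \<bar>det (\<chi> i. b i)\<bar>"
proof -
  let ?Q = "{x :: real ^ 'n. \<forall>j. 0 \<le> x $ j \<and> x $ j < 1}"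
  have cell: "fundamental_cell b = (\<lambda>x. \<Sum>j\<in>UNIV. x $ j *\<^sub>R b j) ` ?Q"
  proof (intro equalityI subsetI)
    fix x assume "x \<in> fundamental_cell b"
    then obtain t where "x = (\<Sum>j\<in>UNIV. t j *\<^sub>R b j)" "\<forall>j. 0 \<le> t j \<and> t j < 1"
      by (auto simp: fundamental_cell_def)
    then show "x \<in> (\<lambda>x. \<Sum>j\<in>UNIV. x $ j *\<^sub>R b j) ` ?Q"
      by (intro image_eqI[of _ _ "\<chi> j. t j"]) auto
  qed (auto simp: fundamental_cell_def)
  have box: "box 0 1 \<subseteq> ?Q" and cbox: "?Q \<subseteq> cbox (0 :: real ^ 'n) 1"
    by (auto simp: mem_box_cart less_imp_le)
  have meas: "?Q \<in> lmeasurable"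
  proof (rule bounded_set_imp_lmeasurable)
    show "bounded ?Q" by (rule bounded_subset[OF bounded_cbox cbox])
    have "?Q \<in> sets borel" by measurable
    then show "?Q \<in> sets lebesgue" by simp
  qed
  have one: "measure lebesgue (cbox (0 :: real ^ 'n) 1) = 1" "measure lebesgue (box (0 :: real ^ 'n) 1) = 1"
  proof -
    have "cbox (0 :: real ^ 'n) 1 \<noteq> {}" by (simp add: interval_eq_empty_cart)
    then show c: "measure lebesgue (cbox (0 :: real ^ 'n) 1) = 1" by (simp add: content_cbox_cart)
    have "measure lborel (box (0 :: real ^ 'n) 1) = measure lborel (cbox (0 :: real ^ 'n) 1)"
      by (simp only: measure_lborel_box_eq measure_lborel_cbox_eq)
    then show "measure lebesgue (box (0 :: real ^ 'n) 1) = 1" using c by simp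
  qed
  have "measure lebesgue ?Q \<le> 1" "1 \<le> measure lebesgue ?Q"
    using measure_mono_fmeasurable[OF cbox, of lebesgue] measure_mono_fmeasurable[OF box, of lebesgue] one
      fmeasurableD[OF meas] meas
    by (simp_all del: measure_completion)
  then show ?thesis unfolding cell measure_combination_image[OF meas] by simp
qed

text \<open>A linear image of the standard simplex, which has volume \<open>1 / n!\<close>.\<close>

lemma measure_convex_hull_0_range:
  fixes y :: "'n::finite \<Rightarrow> real ^ 'n"
  shows "measure lebesgue (convex hull (insert 0 (range y))) = \<bar>det (\<chi> i. y i)\<bar> / fact CARD('n)"
proof -
  let ?f = "\<lambda>x :: real ^ 'n. \<Sum>j\<in>UNIV. x $ j *\<^sub>R y j"
  let ?S = "convex hull (insert 0 Basis) :: (real ^ 'n) set"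
  have lin: "linear ?f" by (rule linearI) (simp_all add: algebra_simps sum.distrib scaleR_sum_right)
  have ax: "?f (axis j 1) = y j" for j
    by (simp add: axis_def if_distrib[of "\<lambda>c. c *\<^sub>R _"] sum.delta cong: if_cong)
  have B: "Basis = range (\<lambda>j. axis j 1 :: real ^ 'n)" by (auto simp: Basis_vec_def)
  have "?f ` Basis = range (\<lambda>j. ?f (axis j 1))" unfolding B by (rule image_image)
  also have "\<dots> = range y" by (simp only: ax)
  finally have "?f ` Basis = range y" .
  then have "?f ` insert 0 Basis = insert 0 (range y)" by simp
  then have "convex hull (insert 0 (range y)) = ?f ` ?S"
    by (simp add: convex_hull_linear_image[OF lin])
  moreover have comp: "compact ?S" by (intro finite_imp_compact_convex_hull) simp
  moreover have "measure lebesgue ?S = 1 / fact CARD('n)"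
    using content_std_simplex[where 'a = "real ^ 'n"] borel_compact[OF comp] by simp
  ultimately show ?thesis
    using measure_combination_image[OF lmeasurable_compact[OF comp], of y] by simp
qed

section \<open>Lattice points, bases and the lattice determinant\<close>

lemma full_lattice_add:
  assumes "full_lattice \<Lambda>" "x \<in> \<Lambda>" "y \<in> \<Lambda>"
  shows "x + y \<in> \<Lambda>"
proof -
  have "0 - y \<in> \<Lambda>" using assms unfolding full_lattice_def by blast
  then have "x - (0 - y) \<in> \<Lambda>" using assms unfolding full_lattice_def by blast
  then show ?thesis by simp
qed

lemma full_lattice_of_nat:
  assumes "full_lattice \<Lambda>" "x \<in> \<Lambda>"
  shows "of_nat m *\<^sub>R x \<in> \<Lambda>"
proof (induction m)
  case 0
  then show ?case using assms by (simp add: full_lattice_def)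
next
  case (Suc m)
  then show ?case using full_lattice_add[OF assms(1) assms(2) Suc] by (simp add: algebra_simps)
qed

lemma full_lattice_of_int:
  assumes "full_lattice \<Lambda>" "x \<in> \<Lambda>"
  shows "of_int m *\<^sub>R x \<in> \<Lambda>"
proof (cases m)
  case (nonneg n)
  then show ?thesis using full_lattice_of_nat[OF assms] by simp
next
  case (neg n)
  have "0 - of_nat (Suc n) *\<^sub>R x \<in> \<Lambda>"
    using full_lattice_of_nat[OF assms, of "Suc n"] assms(1) unfolding full_lattice_def by blast
  moreover have "of_int m *\<^sub>R x = 0 - of_nat (Suc n) *\<^sub>R x" 
    unfolding neg by (simp add: scaleR_minus_left[symmetric] del: scaleR_minus_left)
  ultimately show ?thesis by simp
qed

lemma full_lattice_sum:
  assumes "full_lattice \<Lambda>" "\<And>j. j \<in> J \<Longrightarrow> f j \<in> \<Lambda>"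
  shows "(\<Sum>j\<in>J. f j) \<in> \<Lambda>"
  using assms(2)
proof (induction J rule: infinite_finite_induct)
  case (insert j J)
  then show ?case using full_lattice_add[OF assms(1)] by simp
qed (use assms(1) in \<open>auto simp: full_lattice_def\<close>)

text \<open>The gap around 0 transfers to all pairs of lattice points through their differences, so
  the lattice is uniformly discrete.\<close>

lemma full_lattice_finite_bounded:
  fixes \<Lambda> S :: "(real ^ 'n::finite) set"
  assumes "full_lattice \<Lambda>" "bounded S"
  shows "finite (\<Lambda> \<inter> S)"
proof -
  have "0 isolated_in \<Lambda>" using assms(1) by (simp add: full_lattice_def discreteD)
  then obtain e where e: "0 < e" "\<And>y. y \<in> \<Lambda> \<Longrightarrow> dist 0 y < e \<Longrightarrow> y = 0"
    by (auto simp: isolated_in_dist_Ex_iff)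
  have "uniform_discrete \<Lambda>"
  proof (rule uniformI1[OF e(1)])
    fix x y assume "x \<in> \<Lambda>" "y \<in> \<Lambda>" "dist x y < e"
    then have "y - x \<in> \<Lambda>" "dist 0 (y - x) < e"
      using assms(1) by (auto simp: full_lattice_def dist_norm norm_minus_commute)
    then show "x = y" using e(2)[of "y - x"] by simp
  qed
  then have "uniform_discrete (\<Lambda> \<inter> S)" by (rule uniform_discrete_subset) auto
  moreover have "bounded (\<Lambda> \<inter> S)" using assms(2) by (rule bounded_subset) auto
  ultimately show ?thesis using uniform_discrete_finite_iff by blast
qed

lemma full_lattice_obtain_spanning:
  fixes \<Lambda> :: "(real ^ 'n::finite) set"
  assumes "full_lattice \<Lambda>"
  obtains z :: "'n \<Rightarrow> real ^ 'n" where "range z \<subseteq> \<Lambda>" "det (\<chi> i. z i) \<noteq> 0"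
proof -
  obtain B where B: "B \<subseteq> \<Lambda>" "independent B" "\<Lambda> \<subseteq> span B" by (rule maximal_independent_subset)
  have sp: "span B = UNIV"
    using B(3) assms span_minimal[OF B(3) subspace_span] by (auto simp: full_lattice_def)
  have "card B = dim (UNIV :: (real ^ 'n) set)" using dim_span_eq_card_independent[OF B(2)] sp by simp
  then have "card B = CARD('n)" by simp
  moreover have "finite B" using B(2) by (rule independent_imp_finite)
  ultimately obtain z :: "'n \<Rightarrow> real ^ 'n" where "bij_betw z UNIV B"
    using finite_same_card_bij[of "UNIV :: 'n set" B] by auto
  then have "range z = B" by (rule bij_betw_imp_surj_on)
  then show thesis using that[of z] B(1) sp det_rows_eq_0_iff[of z] by simp
qed

text \<open>Pigeonhole on the fractional parts of the multiples of a lattice vector.\<close>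

lemma full_lattice_bounded_denominator:
  fixes \<Lambda> :: "(real ^ 'n::finite) set"
  assumes L: "full_lattice \<Lambda>" and z: "range z \<subseteq> \<Lambda>" "det (\<chi> i. z i) \<noteq> 0"
  obtains N :: nat where "0 < N"
    "\<And>x. x \<in> \<Lambda> \<Longrightarrow> \<exists>a :: 'n \<Rightarrow> int. of_nat N *\<^sub>R x = (\<Sum>j\<in>UNIV. of_int (a j) *\<^sub>R z j)"
proof -
  \<comment> \<open>\<open>S\<close> contains every combination of the \<open>z j\<close> with
    coefficients in \<open>[0, 1)\<close>.\<close>
  define S where "S = {x :: real ^ 'n. norm x \<le> (\<Sum>j\<in>UNIV. norm (z j))}"
  have "bounded S" unfolding S_def bounded_iff by blast
  define F where "F = \<Lambda> \<inter> S"
  have F: "finite F" unfolding F_def by (rule full_lattice_finite_bounded[OF L \<open>bounded S\<close>])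
  define N where "N = card F"
  \<comment> \<open>Two of the \<open>N + 1\<close> multiples \<open>0, ..., N\<close> share their
    remainder. Their difference \<open>l - k\<close> clears the denominators of \<open>x\<close> and
    divides \<open>fact N\<close>, which therefore works for all \<open>x\<close>.\<close>
  have "\<exists>a :: 'n \<Rightarrow> int. of_nat (fact N) *\<^sub>R x = (\<Sum>j\<in>UNIV. of_int (a j) *\<^sub>R z j)" if x: "x \<in> \<Lambda>" for x
  proof -
    obtain t where t: "x = (\<Sum>j\<in>UNIV. t j *\<^sub>R z j)" using det_rows_nonzero_imp_combination[OF z(2)] .
    define p where "p k = (\<Sum>j\<in>UNIV. frac (of_nat k * t j) *\<^sub>R z j)" for k :: nat
    have p: "p k = of_nat k *\<^sub>R x - (\<Sum>j\<in>UNIV. of_int \<lfloor>of_nat k * t j\<rfloor> *\<^sub>R z j)" for k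
      by (simp add: p_def t frac_def algebra_simps sum_subtractf scaleR_sum_right)
    have "p k \<in> F" for k
    proof -
      have "(\<Sum>j\<in>UNIV. of_int \<lfloor>of_nat k * t j\<rfloor> *\<^sub>R z j) \<in> \<Lambda>"
        using z(1) by (intro full_lattice_sum[OF L] full_lattice_of_int[OF L]) auto
      then have "p k \<in> \<Lambda>"
        unfolding p using full_lattice_of_nat[OF L x] L unfolding full_lattice_def by blast
      moreover have "norm (p k) \<le> (\<Sum>j\<in>UNIV. norm (z j))"
        unfolding p_def
      proof (rule order_trans[OF norm_sum sum_mono])
        fix j
        have "frac (of_nat k * t j) * norm (z j) \<le> 1 * norm (z j)"
          using frac_lt_1[of "of_nat k * t j"] by (intro mult_right_mono) auto
        then show "norm (frac (of_nat k * t j) *\<^sub>R z j) \<le> norm (z j)" by simp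
      qed
      ultimately show ?thesis by (simp add: F_def S_def)
    qed
    then have "p ` {0..N} \<subseteq> F" by auto
    then have "card (p ` {0..N}) < card {0..N}"
      using card_mono[OF F] by (simp add: N_def less_Suc_eq_le)
    then have "\<not> inj_on p {0..N}" by (rule pigeonhole)
    then obtain k l where kl: "k < l" "l \<le> N" "p k = p l"
      by (auto simp: inj_on_def) (metis linorder_neqE_nat)
    then have "of_nat (l - k) *\<^sub>R x
        = (\<Sum>j\<in>UNIV. of_int (\<lfloor>of_nat l * t j\<rfloor> - \<lfloor>of_nat k * t j\<rfloor>) *\<^sub>R z j)"
      using p[of k] p[of l] by (simp add: of_nat_diff algebra_simps sum_subtractf)
    moreover obtain c where c: "fact N = c * (l - k)"
    proof -
      have "(l - k) dvd (fact N :: nat)" using kl by (intro dvd_fact) auto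
      then show thesis using that by (auto simp: dvd_def mult.commute)
    qed
    ultimately have "of_nat (fact N) *\<^sub>R x
        = (\<Sum>j\<in>UNIV. of_int (int c * (\<lfloor>of_nat l * t j\<rfloor> - \<lfloor>of_nat k * t j\<rfloor>)) *\<^sub>R z j)"
      by (simp add: c scaleR_scaleR[symmetric] scaleR_sum_right del: scaleR_scaleR)
    then show ?thesis
      by (intro exI[of _ "\<lambda>j. int c * (\<lfloor>of_nat l * t j\<rfloor> - \<lfloor>of_nat k * t j\<rfloor>)"])
  qed
  then show thesis using that[of "fact N"] by simp
qed

text \<open>A spanning tuple of lattice vectors of minimal absolute determinant is a basis.\<close>

lemma full_lattice_obtain_basis:
  fixes \<Lambda> :: "(real ^ 'n::finite) set"
  assumes L: "full_lattice \<Lambda>"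
  obtains b where "lattice_basis \<Lambda> b"
proof -
  obtain z0 :: "'n \<Rightarrow> real ^ 'n" where z0: "range z0 \<subseteq> \<Lambda>" "det (\<chi> i. z0 i) \<noteq> 0"
    using full_lattice_obtain_spanning[OF L] .
  obtain N :: nat where N: "0 < N"
    "\<And>x. x \<in> \<Lambda> \<Longrightarrow> \<exists>a :: 'n \<Rightarrow> int. of_nat N *\<^sub>R x = (\<Sum>j\<in>UNIV. of_int (a j) *\<^sub>R z0 j)"
    using full_lattice_bounded_denominator[OF L z0] by blast
  \<comment> \<open>All determinants of tuples of lattice vectors are integer multiples of
    \<open>d\<close>, so a smallest nonzero absolute value exists.\<close>
  define d where "d = \<bar>det (\<chi> i. z0 i)\<bar> / of_nat N ^ CARD('n)"
  have d: "0 < d" using z0 N by (simp add: d_def)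
  have mult: "\<exists>m :: nat. \<bar>det (\<chi> i. z i)\<bar> = of_nat m * d" if z: "range z \<subseteq> \<Lambda>" for z :: "'n \<Rightarrow> real ^ 'n"
  proof -
    have "\<forall>i. \<exists>a :: 'n \<Rightarrow> int. of_nat N *\<^sub>R z i = (\<Sum>j\<in>UNIV. of_int (a j) *\<^sub>R z0 j)"
      using z N(2) by auto
    then obtain A :: "'n \<Rightarrow> 'n \<Rightarrow> int" where "\<And>i. of_nat N *\<^sub>R z i = (\<Sum>j\<in>UNIV. of_int (A i j) *\<^sub>R z0 j)"
      by metis
    then obtain m where m: "det (\<chi> i. of_nat N *\<^sub>R z i) = of_int m * det (\<chi> i. z0 i)"
      by (rule det_rows_integer_combination)
    have "det (\<chi> i. of_nat N *\<^sub>R z i) = of_nat N ^ CARD('n) * det (\<chi> i. z i)"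
      using det_rows_mul[of "\<lambda>_. of_nat N" z] by (simp add: scalar_mult_eq_scaleR)
    then have "of_nat N ^ CARD('n) * \<bar>det (\<chi> i. z i)\<bar> = of_nat (nat \<bar>m\<bar>) * \<bar>det (\<chi> i. z0 i)\<bar>"
      using arg_cong[OF m, of abs] by (simp add: abs_mult)
    then have "\<bar>det (\<chi> i. z i)\<bar> = of_nat (nat \<bar>m\<bar>) * d"
      using N(1) by (simp add: d_def field_simps)
    then show ?thesis by blast
  qed
  define Q where "Q m \<longleftrightarrow> (\<exists>z :: 'n \<Rightarrow> real ^ 'n. range z \<subseteq> \<Lambda> \<and> det (\<chi> i. z i) \<noteq> 0 \<and> \<bar>det (\<chi> i. z i)\<bar> = of_nat m * d)" for m
  have "\<exists>m. Q m" using mult[OF z0(1)] z0 unfolding Q_def by blast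
  then have QL: "Q (LEAST m. Q m)" by (rule LeastI_ex)
  then obtain z :: "'n \<Rightarrow> real ^ 'n" where z: "range z \<subseteq> \<Lambda>" "det (\<chi> i. z i) \<noteq> 0"
    "\<bar>det (\<chi> i. z i)\<bar> = of_nat (LEAST m. Q m) * d" unfolding Q_def by blast
  have min: "\<bar>det (\<chi> i. z i)\<bar> \<le> \<bar>det (\<chi> i. w i)\<bar>"
    if w: "range w \<subseteq> \<Lambda>" "det (\<chi> i. w i) \<noteq> 0" for w :: "'n \<Rightarrow> real ^ 'n"
  proof -
    obtain m :: nat where m: "\<bar>det (\<chi> i. w i)\<bar> = of_nat m * d" using mult[OF w(1)] by blast
    then have "Q m" using w unfolding Q_def by blast
    then have "(LEAST m. Q m) \<le> m" by (rule Least_le)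
    then show ?thesis using z(3) m d by simp
  qed
  have "\<exists>a :: 'n \<Rightarrow> int. x = (\<Sum>j\<in>UNIV. of_int (a j) *\<^sub>R z j)" if x: "x \<in> \<Lambda>" for x
  proof -
    obtain t where t: "x = (\<Sum>j\<in>UNIV. t j *\<^sub>R z j)" using det_rows_nonzero_imp_combination[OF z(2)] .
    define p where "p = (\<Sum>j\<in>UNIV. frac (t j) *\<^sub>R z j)"
    have "p = x - (\<Sum>j\<in>UNIV. of_int \<lfloor>t j\<rfloor> *\<^sub>R z j)"
      by (simp add: p_def t frac_def algebra_simps sum_subtractf)
    moreover have "(\<Sum>j\<in>UNIV. of_int \<lfloor>t j\<rfloor> *\<^sub>R z j) \<in> \<Lambda>"
      using z(1) by (intro full_lattice_sum[OF L] full_lattice_of_int[OF L]) auto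
    ultimately have p: "p \<in> \<Lambda>" using x L unfolding full_lattice_def by blast
    have "frac (t k) = 0" for k
    proof (rule ccontr)
      assume nz: "frac (t k) \<noteq> 0"
      \<comment> \<open>Putting the remainder \<open>p\<close> into row \<open>k\<close> scales the
        determinant by \<open>frac (t k)\<close>, which lies strictly between 0 and 1, against
        minimality.\<close>
      define w where "w i = (if i = k then p else z i)" for i
      have "det (\<chi> i. w i) = frac (t k) * det (\<chi> i. z i)"
        unfolding w_def p_def by (rule det_rows_replace)
      moreover have "range w \<subseteq> \<Lambda>" using p z(1) by (auto simp: w_def)
      ultimately have "\<bar>det (\<chi> i. z i)\<bar> \<le> frac (t k) * \<bar>det (\<chi> i. z i)\<bar>"
        using min[of w] nz z(2) by (simp add: abs_mult)
      then show False using z(2) frac_lt_1[of "t k"] by simp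
    qed
    then have "t j = of_int \<lfloor>t j\<rfloor>" for j by (simp add: frac_def)
    then show ?thesis using t by (intro exI[of _ "\<lambda>j. \<lfloor>t j\<rfloor>"]) simp
  qed
  moreover have "(\<Sum>j\<in>UNIV. of_int (a j) *\<^sub>R z j) \<in> \<Lambda>" for a
    using z(1) by (intro full_lattice_sum[OF L] full_lattice_of_int[OF L]) auto
  ultimately have "lattice_basis \<Lambda> z"
    unfolding lattice_basis_def using det_rows_nonzero_imp_independent[OF z(2)] by blast
  then show thesis by (rule that)
qed

lemma lattice_det_obtain_basis:
  fixes \<Lambda> :: "(real ^ 'n::finite) set"
  assumes "full_lattice \<Lambda>"
  obtains b where "lattice_basis \<Lambda> b" "lattice_det \<Lambda> = \<bar>det (\<chi> i. b i)\<bar>"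
proof
  show "lattice_basis \<Lambda> (SOME b. lattice_basis \<Lambda> b)"
    by (metis full_lattice_obtain_basis[OF assms] someI)
  show "lattice_det \<Lambda> = \<bar>det (\<chi> i. (SOME b. lattice_basis \<Lambda> b) i)\<bar>"
    by (simp add: lattice_det_def measure_fundamental_cell)
qed

text \<open>Tuples of lattice vectors are integer combinations of a basis, so their determinants are
  integer multiples of its determinant, and a nonzero integer has modulus at least 1.\<close>

lemma
  fixes \<Lambda> :: "(real ^ 'n::finite) set"
  assumes L: "full_lattice \<Lambda>"
  shows lattice_det_pos: "0 < lattice_det \<Lambda>"
    and lattice_det_le: "\<And>z. range z \<subseteq> \<Lambda> \<Longrightarrow> det (\<chi> i. z i) \<noteq> 0 \<Longrightarrow> lattice_det \<Lambda> \<le> \<bar>det (\<chi> i. z i)\<bar>"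
proof -
  obtain b where b: "lattice_basis \<Lambda> b" and ld: "lattice_det \<Lambda> = \<bar>det (\<chi> i. b i)\<bar>"
    using lattice_det_obtain_basis[OF L] .
  have *: "\<exists>m :: int. det (\<chi> i. z i) = of_int m * det (\<chi> i. b i)" if "range z \<subseteq> \<Lambda>" for z
  proof -
    have "\<forall>i. \<exists>a :: 'n \<Rightarrow> int. z i = (\<Sum>j\<in>UNIV. of_int (a j) *\<^sub>R b j)"
      using that b unfolding lattice_basis_def by blast
    then obtain A :: "'n \<Rightarrow> 'n \<Rightarrow> int" where "\<And>i. z i = (\<Sum>j\<in>UNIV. of_int (A i j) *\<^sub>R b j)" by metis
    then obtain m where "det (\<chi> i. z i) = of_int m * det (\<chi> i. b i)"
      by (rule det_rows_integer_combination)
    then show ?thesis by blast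
  qed
  obtain z0 :: "'n \<Rightarrow> real ^ 'n" where "range z0 \<subseteq> \<Lambda>" "det (\<chi> i. z0 i) \<noteq> 0"
    using full_lattice_obtain_spanning[OF L] .
  then show "0 < lattice_det \<Lambda>" using *[of z0] by (auto simp: ld)
  fix z :: "'n \<Rightarrow> real ^ 'n" assume z: "range z \<subseteq> \<Lambda>" "det (\<chi> i. z i) \<noteq> 0"
  then obtain m :: int where m: "det (\<chi> i. z i) = of_int m * det (\<chi> i. b i)" using * by blast
  then have "1 \<le> \<bar>of_int m :: real\<bar>" using z(2) by (auto simp flip: of_int_abs)
  then have "1 * \<bar>det (\<chi> i. b i)\<bar> \<le> \<bar>of_int m\<bar> * \<bar>det (\<chi> i. b i)\<bar>" by (rule mult_right_mono) simp
  then show "lattice_det \<Lambda> \<le> \<bar>det (\<chi> i. z i)\<bar>" by (simp add: ld m abs_mult)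
qed

section \<open>The lower bound\<close>

lemma convex_body_measure_pos:
  assumes "convex_body K"
  shows "0 < measure lebesgue K"
proof -
  have "\<not> negligible K"
    using assms negligible_convex_interior[of K] by (auto simp: convex_body_def)
  then have "measure lebesgue K \<noteq> 0"
    using assms lmeasurable_compact[of K] negligible_iff_measure[of K] by (auto simp: convex_body_def)
  then show ?thesis by (simp add: zero_less_measure_iff)
qed

lemma centroid_eq_0_imp_integral:
  assumes "convex_body K" "centroid K = 0"
  shows "(LINT x:K|lebesgue. x) = 0"
  using assms convex_body_measure_pos[OF assms(1)] by (simp add: centroid_def)

text \<open>Otherwise some nonzero linear functional is nonnegative on \<open>K\<close>. Its
  integral over \<open>K\<close> is 0, so it vanishes almost everywhere on \<open>K\<close>; then
  \<open>K\<close> lies in a hyperplane up to a null set and has volume 0.\<close>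

lemma centroid_eq_0_imp_interior:
  fixes K :: "(real ^ 'n) set"
  assumes K: "convex_body K" and c: "centroid K = 0"
  shows "0 \<in> interior K"
proof (rule ccontr)
  assume "0 \<notin> interior K"
  have K': "compact K" "convex K" "interior K \<noteq> {}" using K by (auto simp: convex_body_def)
  obtain a where a: "a \<noteq> 0" "\<And>x. x \<in> interior K \<Longrightarrow> 0 \<le> a \<bullet> x"
    using separating_hyperplane_set_0[of "interior K"] K' \<open>0 \<notin> interior K\<close> by (auto simp: convex_interior)
  have "K \<subseteq> closure (interior K)"
    using convex_closure_interior[OF K'(2,3)] closure_subset by blast
  also have "\<dots> \<subseteq> {x. a \<bullet> x \<ge> 0}"
    using a(2) by (intro closure_minimal closed_halfspace_ge) auto
  finally have nonneg: "0 \<le> a \<bullet> x" if "x \<in> K" for x using that by auto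
  have [measurable]: "K \<in> sets borel" using K'(1) by (rule borel_compact)
  note zero = centroid_eq_0_imp_integral[OF K c]
  have int: "integrable lborel (\<lambda>x. indicator K x * (a \<bullet> x))"
    and val: "(LINT x|lborel. indicator K x * (a \<bullet> x)) = 0"
    using lebesgue_integral_zero_imp_affine[OF K'(1) zero, of 0 "- a"] by simp_all
  have "AE x in lborel. indicator K x * (a \<bullet> x) = 0"
    using integral_nonneg_eq_0_iff_AE[OF int] val nonneg by (auto simp: indicator_def)
  then have "AE x in lborel. \<not> (x \<in> K \<and> a \<bullet> x \<noteq> 0)" by eventually_elim (auto simp: indicator_def)
  then have "{x. x \<in> K \<and> a \<bullet> x \<noteq> 0} \<in> null_sets lborel"
    by (subst (asm) AE_iff_null) auto
  then have "negligible {x. x \<in> K \<and> a \<bullet> x \<noteq> 0}"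
    by (simp add: negligible_iff_null_sets null_sets_completionI)
  moreover have "negligible {x. a \<bullet> x = 0}" using a(1) by (intro negligible_hyperplane) auto
  ultimately have "negligible ({x. x \<in> K \<and> a \<bullet> x \<noteq> 0} \<union> {x. a \<bullet> x = 0})" by (rule negligible_Un)
  then have "negligible K" by (rule negligible_subset) auto
  then show False using convex_body_measure_pos[OF K] negligible_imp_measure0 by force
qed

section \<open>Admissible radii\<close>

text \<open>The set under the infimum of \<open>packing_minimum\<close>. The volume bound is proved
  for its elements first, so the infimum never has to be attained.\<close>

definition packing_radii :: "nat \<Rightarrow> (real ^ 'n) set \<Rightarrow> (real ^ 'n) set \<Rightarrow> real set" where
  "packing_radii i K \<Lambda> = {\<rho>. 0 < \<rho> \<and>
     (\<forall>L \<in> grassmannian (CARD('n) - i). ((*\<^sub>R) \<rho> ` K + L) \<inter> \<Lambda> \<noteq> L \<inter> \<Lambda>)}"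

lemma packing_minimum_eq_Inf: "packing_minimum i K \<Lambda> = Inf (packing_radii i K \<Lambda>)"
  by (simp add: packing_minimum_def packing_radii_def)

text \<open>As \<open>0 \<in> K\<close>, the sum contains \<open>L\<close>, so the two intersections
  differ exactly if a lattice point of the sum lies outside \<open>L\<close>.\<close>

lemma translates_meet_iff:
  fixes K L \<Lambda> :: "(real ^ 'n) set"
  assumes "0 \<in> K"
  shows "((*\<^sub>R) \<rho> ` K + L) \<inter> \<Lambda> \<noteq> L \<inter> \<Lambda> \<longleftrightarrow> (\<exists>x\<in>K. \<exists>l\<in>L. \<rho> *\<^sub>R x + l \<in> \<Lambda> - L)"
proof -
  have "L \<subseteq> (*\<^sub>R) \<rho> ` K + L"
  proof
    fix l assume "l \<in> L"
    then have "\<rho> *\<^sub>R 0 + l \<in> (*\<^sub>R) \<rho> ` K + L" using assms by (intro set_plus_intro imageI)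
    then show "l \<in> (*\<^sub>R) \<rho> ` K + L" by simp
  qed
  then show ?thesis by (auto simp: set_plus_def)
qed

text \<open>A large multiple of \<open>K\<close> contains a spanning tuple of lattice vectors, and a
  proper subspace misses one of them. The \<open>+ 1\<close> in \<open>\<rho>\<close> makes
  positivity immediate.\<close>

lemma packing_radii_nonempty:
  fixes K \<Lambda> :: "(real ^ 'n) set"
  assumes "0 \<in> interior K" and L: "full_lattice \<Lambda>" and i: "1 \<le> i" "i \<le> CARD('n)"
  shows "packing_radii i K \<Lambda> \<noteq> {}"
proof -
  obtain e where e: "0 < e" "cball 0 e \<subseteq> K" using assms(1) by (auto simp: mem_interior_cball)
  obtain z :: "'n \<Rightarrow> real ^ 'n" where z: "range z \<subseteq> \<Lambda>" "det (\<chi> i. z i) \<noteq> 0"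
    using full_lattice_obtain_spanning[OF L] .
  define \<rho> where "\<rho> = (\<Sum>j\<in>UNIV. norm (z j)) / e + 1"
  have \<rho>: "0 < \<rho>" using e(1) by (simp add: \<rho>_def add_nonneg_pos sum_nonneg)
  have zK: "(1 / \<rho>) *\<^sub>R z j \<in> K" for j
  proof -
    have "norm (z j) \<le> (\<Sum>j\<in>UNIV. norm (z j))" by (rule member_le_sum) auto
    also have "\<dots> \<le> \<rho> * e" using e(1) by (simp add: \<rho>_def field_simps)
    finally have "norm ((1 / \<rho>) *\<^sub>R z j) \<le> e" using \<rho> by (simp add: field_simps)
    then show ?thesis using e(2) by auto
  qed
  have "((*\<^sub>R) \<rho> ` K + L) \<inter> \<Lambda> \<noteq> L \<inter> \<Lambda>" if L: "L \<in> grassmannian (CARD('n) - i)" for L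
  proof -
    have sub: "subspace L" and dim: "dim L < CARD('n)" using L i by (auto simp: grassmannian_def)
    have "\<exists>j. z j \<notin> L"
    proof (rule ccontr)
      assume "\<not> (\<exists>j. z j \<notin> L)"
      then have "span (range z) \<subseteq> L" using sub by (intro span_minimal) auto
      then have "L = UNIV" using z(2) det_rows_eq_0_iff[of z] by auto
      then show False using dim by simp
    qed
    then obtain j where "z j \<notin> L" by blast
    then have "\<rho> *\<^sub>R ((1 / \<rho>) *\<^sub>R z j) + 0 \<in> \<Lambda> - L" using z(1) \<rho> by auto
    moreover have "0 \<in> L" using sub by (rule subspace_0)
    moreover have "0 \<in> K" using assms(1) interior_subset by blast
    ultimately show ?thesis using zK by (subst translates_meet_iff) blast+
  qed
  then show ?thesis using \<rho> by (auto simp: packing_radii_def)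
qed

section \<open>Greedy choice of lattice vectors\<close>

lemma dim_greedy:
  fixes z :: "nat \<Rightarrow> 'a::euclidean_space"
  assumes "\<And>k. k < m \<Longrightarrow> z k \<notin> span (z ` {..<k})"
  shows "dim (z ` {..<m}) = m"
  using assms by (induction m) (auto simp: lessThan_Suc dim_insert)

text \<open>The span of the first \<open>k\<close> vectors has dimension \<open>k\<close>, the
  dimension tested by the index \<open>CARD('n) - k\<close>; hence the reversed order of the radii.
  The congruence modulo the span makes the passage from \<open>z\<close> to the scaled
  \<open>x\<close> triangular.\<close>

lemma greedy_lattice_vectors:
  fixes K \<Lambda> :: "(real ^ 'n) set"
  assumes "0 \<in> K" and r: "\<And>i. 1 \<le> i \<Longrightarrow> i \<le> CARD('n) \<Longrightarrow> r i \<in> packing_radii i K \<Lambda>"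
    and "m \<le> CARD('n)"
  shows "\<exists>z x. \<forall>k<m. z k \<in> \<Lambda> \<and> x k \<in> K \<and> z k \<notin> span (z ` {..<k})
    \<and> r (CARD('n) - k) *\<^sub>R x k - z k \<in> span (z ` {..<k})"
  using assms(3)
proof (induction m)
  case (Suc m)
  then obtain z x where zx: "\<And>k. k < m \<Longrightarrow> z k \<in> \<Lambda> \<and> x k \<in> K \<and> z k \<notin> span (z ` {..<k})
    \<and> r (CARD('n) - k) *\<^sub>R x k - z k \<in> span (z ` {..<k})" by auto
  define L where "L = span (z ` {..<m})"
  have "dim L = m" unfolding L_def dim_span using zx by (intro dim_greedy) auto
  \<comment> \<open>The dimension \<open>m\<close> is written in the form that the packing minimum
    of index \<open>CARD('n) - m\<close> uses.\<close>
  then have "L \<in> grassmannian (CARD('n) - (CARD('n) - m))"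
    using Suc.prems by (simp add: grassmannian_def L_def)
  moreover have "r (CARD('n) - m) \<in> packing_radii (CARD('n) - m) K \<Lambda>" using Suc.prems by (intro r) auto
  ultimately have "((*\<^sub>R) (r (CARD('n) - m)) ` K + L) \<inter> \<Lambda> \<noteq> L \<inter> \<Lambda>" by (simp add: packing_radii_def)
  then obtain y l where yl: "y \<in> K" "l \<in> L" "r (CARD('n) - m) *\<^sub>R y + l \<in> \<Lambda> - L"
    using translates_meet_iff[OF assms(1)] by blast
  define z' where "z' = z(m := r (CARD('n) - m) *\<^sub>R y + l)"
  have z': "z' ` {..<k} = z ` {..<k}" if "k \<le> m" for k
    using that by (auto simp: z'_def)
  have "z' k \<in> \<Lambda> \<and> (x(m := y)) k \<in> K \<and> z' k \<notin> span (z' ` {..<k})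
    \<and> r (CARD('n) - k) *\<^sub>R (x(m := y)) k - z' k \<in> span (z' ` {..<k})" if "k < Suc m" for k
  proof (cases "k = m")
    case True
    have "- l \<in> L" using yl(2) unfolding L_def by (rule span_neg)
    then show ?thesis using yl True z'[of m] by (simp add: z'_def L_def)
  next
    case False
    then show ?thesis using zx[of k] that z'[of k] by (simp add: z'_def)
  qed
  then show ?case by blast
qed simp

text \<open>The rows are exchanged one at a time, those of largest \<open>idx\<close> first. When
  row \<open>k\<close> changes, the rows of smaller index are still those of \<open>Z\<close>, so
  the change is a combination of other rows.\<close>

lemma det_triangular_replace:
  fixes Z X :: "'n::finite \<Rightarrow> real ^ 'n" and idx :: "'n \<Rightarrow> nat"
  assumes inj: "inj idx" and X: "\<And>j. X j - Z j \<in> span (Z ` {i. idx i < idx j})"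
  shows "det (\<chi> j. X j) = det (\<chi> j. Z j)"
proof -
  \<comment> \<open>The intermediate matrix in which the rows of index at least \<open>m\<close> are
    already exchanged; values \<open>m\<close> outside the range of \<open>idx\<close> cause no
    change.\<close>
  define W where "W m j = (if m \<le> idx j then X j else Z j)" for m j
  obtain M where M: "\<And>j. idx j < M"
    using finite_nat_set_iff_bounded[of "range idx"] by auto
  have step: "det (\<chi> j. W m j) = det (\<chi> j. W (Suc m) j)" for m
  proof (cases "m \<in> range idx")
    case True
    then obtain k where k: "idx k = m" by auto
    have "Z ` {i. idx i < m} \<subseteq> W (Suc m) ` (- {k})"
      using k by (auto simp: W_def intro!: image_eqI)
    then have "X k - Z k \<in> span (W (Suc m) ` (- {k}))"
      using X[of k] span_mono k by blast
    from det_rows_replace_combination[OF this, of 1]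
    have "det (\<chi> i. if i = k then 1 *\<^sub>R W (Suc m) k + (X k - Z k) else W (Suc m) i) = det (\<chi> j. W (Suc m) j)"
      by simp
    moreover have "(if i = k then 1 *\<^sub>R W (Suc m) k + (X k - Z k) else W (Suc m) i) = W m i" for i
      using k inj_eq[OF inj, of i k] by (auto simp: W_def)
    ultimately show ?thesis by (simp only:)
  next
    case False
    then have "W m j = W (Suc m) j" for j
      by (auto simp: W_def not_less_eq_eq dest: le_antisym)
    then show ?thesis by simp
  qed
  have "det (\<chi> j. W 0 j) = det (\<chi> j. W m j)" for m
    by (induction m) (simp_all add: step[symmetric])
  then have "det (\<chi> j. W 0 j) = det (\<chi> j. W M j)" .
  moreover have "W 0 j = X j" "W M j = Z j" for j using M[of j] by (auto simp: W_def)
  ultimately show ?thesis by simp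
qed

lemma packing_radii_volume_bound:
  fixes K \<Lambda> :: "(real ^ 'n) set"
  assumes K: "convex_body K" "centroid K = 0" and L: "full_lattice \<Lambda>"
    and r: "\<And>i. 1 \<le> i \<Longrightarrow> i \<le> CARD('n) \<Longrightarrow> r i \<in> packing_radii i K \<Lambda>"
  shows "real (CARD('n) + 1) / fact CARD('n) * (\<Prod>i = 1..CARD('n). 1 / r i)
    \<le> measure lebesgue K / lattice_det \<Lambda>"
proof -
  let ?n = "CARD('n)"
  have "0 \<in> K" using centroid_eq_0_imp_interior[OF K] interior_subset by blast
  have "\<exists>z x. \<forall>k<?n. z k \<in> \<Lambda> \<and> x k \<in> K \<and> z k \<notin> span (z ` {..<k})
      \<and> r (?n - k) *\<^sub>R x k - z k \<in> span (z ` {..<k})"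
    by (rule greedy_lattice_vectors[OF \<open>0 \<in> K\<close> r order_refl])
  then obtain z x where zx': "\<forall>k<?n. z k \<in> \<Lambda> \<and> x k \<in> K \<and> z k \<notin> span (z ` {..<k})
      \<and> r (?n - k) *\<^sub>R x k - z k \<in> span (z ` {..<k})" by (elim exE)
  have zx: "z k \<in> \<Lambda> \<and> x k \<in> K \<and> z k \<notin> span (z ` {..<k})
      \<and> r (?n - k) *\<^sub>R x k - z k \<in> span (z ` {..<k})" if "k < ?n" for k
    by (rule zx'[rule_format, OF that])
  \<comment> \<open>The greedy sequences are indexed by numbers, the determinants by
    \<open>'n\<close>; \<open>idx\<close> translates between them.\<close>
  obtain idx :: "'n \<Rightarrow> nat" where "bij_betw idx UNIV {0..<?n}"
    using ex_bij_betw_finite_nat[OF finite_class.finite_UNIV] by blast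
  then have idx: "bij_betw idx UNIV {..<?n}" by (simp add: atLeast0LessThan)
  then have idx_less: "idx j < ?n" for j using bij_betwE by fastforce
  have range: "range idx = {..<?n}" using idx by (rule bij_betw_imp_surj_on)
  have inj: "inj idx" using idx by (rule bij_betw_imp_inj_on)
  define Z Y R where "Z j = z (idx j)" and "Y j = x (idx j)" and "R j = r (?n - idx j)" for j
  have "range Z = z ` range idx" by (auto simp: Z_def)
  then have "dim (range Z) = ?n" unfolding range using zx dim_greedy[of ?n z] by simp
  then have "span (range Z) = UNIV" using dim_eq_full[of "range Z"] by simp
  then have detZ: "det (\<chi> j. Z j) \<noteq> 0" using det_rows_eq_0_iff by blast
  have Zrange: "range Z \<subseteq> \<Lambda>" using zx idx_less by (auto simp: Z_def)
  have eq: "det (\<chi> j. R j *\<^sub>R Y j) = det (\<chi> j. Z j)"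
  proof (rule det_triangular_replace[OF inj])
    fix j
    have "{..<idx j} = idx ` {i. idx i < idx j}"
    proof (intro equalityI subsetI)
      fix k assume k: "k \<in> {..<idx j}"
      then have "k \<in> range idx" unfolding range using idx_less[of j] by auto
      then show "k \<in> idx ` {i. idx i < idx j}" using k by auto
    qed auto
    then have "z ` {..<idx j} = Z ` {i. idx i < idx j}" by (simp add: image_image Z_def)
    then show "R j *\<^sub>R Y j - Z j \<in> span (Z ` {i. idx i < idx j})"
      using zx[OF idx_less[of j]] by (simp add: R_def Y_def Z_def)
  qed
  have prodR: "(\<Prod>j\<in>UNIV. R j) = (\<Prod>i = 1..?n. r i)"
  proof -
    have "(\<Prod>j\<in>UNIV. R j) = (\<Prod>k\<in>{..<?n}. r (?n - k))"
      unfolding R_def by (rule prod.reindex_bij_betw[OF idx])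
    also have "\<dots> = (\<Prod>i = 1..?n. r i)"
      by (rule prod.reindex_bij_witness[of _ "\<lambda>i. ?n - i" "\<lambda>k. ?n - k"]) auto
    finally show ?thesis .
  qed
  have rpos: "0 < r i" if "1 \<le> i" "i \<le> ?n" for i using r[OF that] by (simp add: packing_radii_def)
  have ppos: "0 < (\<Prod>i = 1..?n. r i)" using rpos by (intro prod_pos) auto
  have det: "(\<Prod>i = 1..?n. r i) * det (\<chi> j. Y j) = det (\<chi> j. Z j)"
    using det_rows_mul[of R Y] eq prodR by (simp add: scalar_mult_eq_scaleR)
  then have detY: "det (\<chi> j. Y j) \<noteq> 0" using detZ by auto
  then have "surj ((*v) (\<chi> j. Y j))"
    using invertible_det_nz invertible_right_inverse matrix_right_invertible_surjective by blast
  \<comment> \<open>Invertibility of the matrix with rows \<open>Y j\<close> provides the functional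
    that is 1 on all \<open>Y j\<close>, as the simplex bound requires.\<close>
  then obtain b where b: "(\<chi> j. Y j) *v b = (\<chi> j. 1)" by (metis surjD)
  have "b \<bullet> Y j = 1" for j
  proof -
    have "((\<chi> j. Y j) *v b) $ j = Y j \<bullet> b" by (simp add: matrix_vector_mul_component)
    then show ?thesis using b by (simp add: inner_commute)
  qed
  moreover have "insert 0 (range Y) \<subseteq> K" using zx idx_less \<open>0 \<in> K\<close> by (auto simp: Y_def)
  ultimately have "real (DIM(real ^ 'n) + 1) * measure lebesgue (convex hull (insert 0 (range Y))) \<le> measure lebesgue K"
    using K centroid_eq_0_imp_integral[OF K]
    by (intro measure_ge_simplex_of_centroid[of K "range Y" b]) (auto simp: convex_body_def)
  then have 1: "real (?n + 1) / fact ?n * \<bar>det (\<chi> j. Y j)\<bar> \<le> measure lebesgue K"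
    by (simp add: measure_convex_hull_0_range)
  \<comment> \<open>The right-hand side is the modulus of the determinant of the greedy lattice
    vectors \<open>Z\<close>.\<close>
  have "lattice_det \<Lambda> \<le> (\<Prod>i = 1..?n. r i) * \<bar>det (\<chi> j. Y j)\<bar>"
    using lattice_det_le[OF L Zrange detZ] ppos unfolding det[symmetric] abs_mult by simp
  then have "lattice_det \<Lambda> * (\<Prod>i = 1..?n. 1 / r i) \<le> \<bar>det (\<chi> j. Y j)\<bar>"
    using ppos by (simp add: prod_dividef pos_divide_le_eq mult.commute)
  then have "real (?n + 1) / fact ?n * (lattice_det \<Lambda> * (\<Prod>i = 1..?n. 1 / r i))
      \<le> real (?n + 1) / fact ?n * \<bar>det (\<chi> j. Y j)\<bar>" by (intro mult_left_mono) auto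
  then have "real (?n + 1) / fact ?n * (\<Prod>i = 1..?n. 1 / r i) * lattice_det \<Lambda> \<le> measure lebesgue K"
    using 1 by (simp add: mult_ac)
  then show ?thesis using lattice_det_pos[OF L] by (simp add: pos_le_divide_eq)
qed

text \<open>For each \<open>\<delta> > 0\<close> there are admissible radii below
  \<open>(1 + \<delta>)\<close> times the packing minima. Their volume bound loses a factor
  \<open>(1 + \<delta>) ^ n\<close>, which tends to 1.\<close>

lemma packing_minima_volume_bound:
  fixes K \<Lambda> :: "(real ^ 'n) set"
  assumes K: "convex_body K" "centroid K = 0" and L: "full_lattice \<Lambda>"
  shows "real (CARD('n) + 1) / fact CARD('n) * (\<Prod>i = 1..CARD('n). 1 / packing_minimum i K \<Lambda>)
    \<le> measure lebesgue K / lattice_det \<Lambda>"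
proof -
  let ?n = "CARD('n)" and ?\<rho> = "\<lambda>i. packing_minimum i K \<Lambda>"
  let ?B = "measure lebesgue K / lattice_det \<Lambda>"
  have ne: "packing_radii i K \<Lambda> \<noteq> {}" if "1 \<le> i" "i \<le> ?n" for i
    using packing_radii_nonempty[OF centroid_eq_0_imp_interior[OF K] L that] .
  have nn: "0 \<le> ?\<rho> i" if "1 \<le> i" "i \<le> ?n" for i
    unfolding packing_minimum_eq_Inf using ne[OF that]
    by (intro cInf_greatest) (auto simp: packing_radii_def)
  have B: "0 \<le> ?B" using lattice_det_pos[OF L] by simp
  show ?thesis
  proof (cases "\<exists>i\<in>{1..?n}. ?\<rho> i = 0")
    \<comment> \<open>Here \<open>1 / 0 = 0\<close> makes the whole product vanish.\<close>
    case True
    then have "(\<Prod>i = 1..?n. 1 / ?\<rho> i) = 0" by (intro prod_zero) auto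
    then show ?thesis using B by (simp only: mult_zero_right)
  next
    case False
    then have pos: "0 < ?\<rho> i" if "1 \<le> i" "i \<le> ?n" for i using nn[OF that] that by (force simp: less_le)
    let ?A = "real (?n + 1) / fact ?n * (\<Prod>i = 1..?n. 1 / ?\<rho> i)"
    have bd: "?A \<le> ?B * (1 + \<delta>) ^ ?n" if \<delta>: "0 < \<delta>" for \<delta>
    proof -
      have "\<exists>s. 1 \<le> i \<longrightarrow> i \<le> ?n \<longrightarrow> s \<in> packing_radii i K \<Lambda> \<and> s < ?\<rho> i * (1 + \<delta>)" for i
      proof (cases "1 \<le> i \<and> i \<le> ?n")
        case True
        then have "Inf (packing_radii i K \<Lambda>) < ?\<rho> i * (1 + \<delta>)"
          using pos[of i] \<delta> by (simp add: packing_minimum_eq_Inf[symmetric])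
        then show ?thesis using cInf_lessD[OF ne] True by blast
      qed blast
      then obtain r where r: "\<And>i. 1 \<le> i \<Longrightarrow> i \<le> ?n \<Longrightarrow> r i \<in> packing_radii i K \<Lambda>"
        "\<And>i. 1 \<le> i \<Longrightarrow> i \<le> ?n \<Longrightarrow> r i < ?\<rho> i * (1 + \<delta>)" by metis
      have "(\<Prod>i = 1..?n. 1 / (?\<rho> i * (1 + \<delta>))) \<le> (\<Prod>i = 1..?n. 1 / r i)"
      proof (rule prod_mono)
        fix i assume "i \<in> {1..?n}"
        then have i: "1 \<le> i" "i \<le> ?n" by auto
        have "0 < r i" using r(1)[OF i] by (simp add: packing_radii_def)
        then show "0 \<le> 1 / (?\<rho> i * (1 + \<delta>)) \<and> 1 / (?\<rho> i * (1 + \<delta>)) \<le> 1 / r i"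
          using pos[OF i] \<delta> r(2)[OF i] by (auto intro!: divide_left_mono)
      qed
      moreover have "(\<Prod>i = 1..?n. 1 / (?\<rho> i * (1 + \<delta>))) = (\<Prod>i = 1..?n. 1 / ?\<rho> i) / (1 + \<delta>) ^ ?n"
        by (simp add: prod_dividef prod.distrib)
      ultimately have "real (?n + 1) / fact ?n * ((\<Prod>i = 1..?n. 1 / ?\<rho> i) / (1 + \<delta>) ^ ?n)
          \<le> real (?n + 1) / fact ?n * (\<Prod>i = 1..?n. 1 / r i)" by (intro mult_left_mono) auto
      also have "\<dots> \<le> ?B" by (rule packing_radii_volume_bound[OF K L r(1)])
      finally have "?A / (1 + \<delta>) ^ ?n \<le> ?B" by (simp only: times_divide_eq_right)
      moreover have "0 < (1 + \<delta>) ^ ?n" using \<delta> by simp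
      ultimately show ?thesis by (simp only: pos_divide_le_eq)
    qed
    have "(\<lambda>k. ?B * (1 + inverse (real (Suc k))) ^ ?n) \<longlonglongrightarrow> ?B * (1 + 0) ^ ?n"
      by (intro tendsto_intros LIMSEQ_inverse_real_of_nat)
    then have "?A \<le> ?B * (1 + 0) ^ ?n"
      by (rule LIMSEQ_le_const) (use bd in auto)
    then show ?thesis by simp
  qed
qed

section \<open>The extremal simplex\<close>

definition int_lattice :: "(real ^ 'n) set" where
  "int_lattice = {x. \<forall>j. x $ j \<in> \<int>}"

text \<open>The vector \<open>- 1\<close> has all coordinates \<open>-1\<close>, so the
  \<open>n + 1\<close> vertices sum to 0.\<close>

definition extremal_simplex :: "(real ^ 'n) set" where
  "extremal_simplex = convex hull (insert (- 1) (range (\<lambda>j. axis j 1)))"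

lemma det_axis: "det (\<chi> i. (axis i 1 :: real ^ 'n)) = 1"
proof -
  have "(\<chi> i. (axis i 1 :: real ^ 'n)) = mat 1" by (simp add: vec_eq_iff mat_def axis_def)
  then show ?thesis by simp
qed

lemma vec_eq_sum_axis: "x = (\<Sum>j\<in>UNIV. x $ j *\<^sub>R axis j (1::real))"
  by (simp add: vec_eq_iff axis_def if_distrib[of "\<lambda>c. _ * c"] cong: if_cong)

lemma full_lattice_int_lattice: "full_lattice (int_lattice :: (real ^ 'n) set)"
proof -
  have "x isolated_in int_lattice" if x: "x \<in> int_lattice" for x :: "real ^ 'n"
  proof -
    have "y = x" if y: "y \<in> int_lattice" and d: "dist x y < 1" for y :: "real ^ 'n"
    proof -
      have "y $ j = x $ j" for j
      proof -
        have "x $ j - y $ j \<in> \<int>" using x y by (simp add: int_lattice_def)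
        moreover have "\<bar>x $ j - y $ j\<bar> < 1"
          using d component_le_norm_cart[of "x - y" j] by (simp add: dist_norm)
        ultimately show ?thesis using Ints_nonzero_abs_less1 by force
      qed
      then show ?thesis by (simp add: vec_eq_iff)
    qed
    then show ?thesis using x by (auto simp: isolated_in_dist_Ex_iff intro!: exI[of _ 1])
  qed
  moreover have "span (int_lattice :: (real ^ 'n) set) = UNIV"
  proof -
    have "range (\<lambda>j. axis j 1) \<subseteq> (int_lattice :: (real ^ 'n) set)" by (auto simp: int_lattice_def axis_def)
    moreover have "span (range (\<lambda>j. axis j 1 :: real ^ 'n)) = UNIV"
      using det_rows_eq_0_iff[of "\<lambda>j. axis j 1 :: real ^ 'n"] by (simp add: det_axis)
    ultimately show ?thesis using span_mono by blast
  qed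
  ultimately show ?thesis
    unfolding full_lattice_def by (auto simp: int_lattice_def intro: discreteI)
qed

text \<open>A basis consists of integer vectors, so its determinant is a nonzero integer. The lower
  bound suffices for sharpness, where the determinant is a denominator.\<close>

lemma one_le_lattice_det_int_lattice: "1 \<le> lattice_det (int_lattice :: (real ^ 'n) set)"
proof -
  obtain b where b: "lattice_basis (int_lattice :: (real ^ 'n) set) b"
    and ld: "lattice_det (int_lattice :: (real ^ 'n) set) = \<bar>det (\<chi> i. b i)\<bar>"
    using lattice_det_obtain_basis[OF full_lattice_int_lattice] .
  have "b i \<in> int_lattice" for i
  proof -
    have eq: "(int_lattice :: (real ^ 'n) set) = {(\<Sum>j\<in>UNIV. of_int (z j) *\<^sub>R b j) | z :: 'n \<Rightarrow> int. True}"
      using b unfolding lattice_basis_def by (elim conjE)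
    have "(\<Sum>j\<in>UNIV. of_int (if j = i then 1 else 0) *\<^sub>R b j) = (\<Sum>j\<in>UNIV. if j = i then b j else 0)"
      by (rule sum.cong) auto
    also have "\<dots> = b i" by (subst sum.delta) simp_all
    finally have "b i = (\<Sum>j\<in>UNIV. of_int (if j = i then 1 else 0) *\<^sub>R b j)" by (rule sym)
    then have "\<exists>z :: 'n \<Rightarrow> int. b i = (\<Sum>j\<in>UNIV. of_int (z j) *\<^sub>R b j) \<and> True"
      by (intro exI[of _ "\<lambda>j. if j = i then 1 else 0"] conjI TrueI)
    then show ?thesis unfolding eq by (rule CollectI)
  qed
  then have "b i $ j \<in> \<int>" for i j by (simp add: int_lattice_def)
  then have "det (\<chi> i. b i) \<in> \<int>" unfolding det_def by (intro Ints_sum Ints_mult Ints_prod) auto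
  moreover have "det (\<chi> i. b i) \<noteq> 0"
    using lattice_det_pos[OF full_lattice_int_lattice, where 'n = 'n] by (auto simp: ld)
  ultimately show ?thesis unfolding ld using Ints_nonzero_abs_ge1 by blast
qed

text \<open>The missing weight is put on 0.\<close>

lemma sub_convex_sum:
  assumes C: "convex C" "0 \<in> C" and "finite J" and c: "\<And>j. j \<in> J \<Longrightarrow> 0 \<le> c j" "(\<Sum>j\<in>J. c j) \<le> 1"
    and y: "\<And>j. j \<in> J \<Longrightarrow> y j \<in> C"
  shows "(\<Sum>j\<in>J. c j *\<^sub>R y j) \<in> C"
proof (cases "(\<Sum>j\<in>J. c j) = 0")
  case True
  then have "\<And>j. j \<in> J \<Longrightarrow> c j = 0" using sum_nonneg_eq_0_iff[OF \<open>finite J\<close>] c(1) by blast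
  then show ?thesis using C(2) by simp
next
  case False
  define s where "s = (\<Sum>j\<in>J. c j)"
  have s: "0 < s" "s \<le> 1" using False c sum_nonneg[of J c] by (auto simp: s_def less_le)
  have "(\<Sum>j\<in>J. (c j / s) *\<^sub>R y j) \<in> C"
    using s c(1) y \<open>finite J\<close> C(1)
    by (intro convex_sum) (auto simp: sum_divide_distrib[symmetric] s_def[symmetric])
  then have "(1 - s) *\<^sub>R 0 + s *\<^sub>R (\<Sum>j\<in>J. (c j / s) *\<^sub>R y j) \<in> C"
    using s C by (intro convexD) auto
  then show ?thesis using s by (simp add: scaleR_sum_right)
qed

lemma extremal_simplex_vertices:
  "- 1 \<in> (extremal_simplex :: (real ^ 'n) set)" "axis j 1 \<in> (extremal_simplex :: (real ^ 'n) set)"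
  by (auto simp: extremal_simplex_def intro: hull_inc)

lemma convex_extremal_simplex: "convex (extremal_simplex :: (real ^ 'n) set)"
  by (simp add: extremal_simplex_def)

lemma compact_extremal_simplex: "compact (extremal_simplex :: (real ^ 'n) set)"
  unfolding extremal_simplex_def by (intro finite_imp_compact_convex_hull) auto

text \<open>0 is the barycentre of the vertices: \<open>- 1\<close> has weight
  \<open>1 / (n + 1)\<close>, the mean of the unit vectors has weight
  \<open>n / (n + 1)\<close>.\<close>

lemma zero_in_extremal_simplex: "0 \<in> (extremal_simplex :: (real ^ 'n) set)"
proof -
  let ?n = "real CARD('n)"
  have "(\<Sum>j\<in>UNIV. (1 / ?n) *\<^sub>R axis j 1) \<in> (extremal_simplex :: (real ^ 'n) set)"
    by (intro convex_sum extremal_simplex_vertices convex_extremal_simplex) auto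
  then have "(1 / (?n + 1)) *\<^sub>R (- 1) + (?n / (?n + 1)) *\<^sub>R (\<Sum>j\<in>UNIV. (1 / ?n) *\<^sub>R axis j 1)
      \<in> (extremal_simplex :: (real ^ 'n) set)"
    by (intro convexD extremal_simplex_vertices convex_extremal_simplex)
      (auto simp: add_divide_distrib[symmetric])
  moreover have "(1 / (?n + 1)) *\<^sub>R (- 1) + (?n / (?n + 1)) *\<^sub>R (\<Sum>j\<in>UNIV. (1 / ?n) *\<^sub>R axis j 1) = (0 :: real ^ 'n)"
    by (simp add: vec_eq_iff axis_def if_distrib[of "\<lambda>c. _ * c"] cong: if_cong)
  ultimately show ?thesis by simp
qed

text \<open>The standard simplex, of volume \<open>1 / n!\<close>, lies inside.\<close>

lemma convex_body_extremal_simplex: "convex_body (extremal_simplex :: (real ^ 'n) set)"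
proof -
  let ?S = "convex hull (insert 0 (range (\<lambda>j. axis j 1))) :: (real ^ 'n) set"
  have "?S \<subseteq> extremal_simplex"
    using zero_in_extremal_simplex extremal_simplex_vertices convex_extremal_simplex
    by (intro hull_minimal) auto
  moreover have "\<not> negligible ?S"
  proof
    assume "negligible ?S"
    then have "measure lebesgue ?S = 0" by (rule negligible_imp_measure0)
    then show False using measure_convex_hull_0_range[of "\<lambda>j. axis j 1 :: real ^ 'n"] by (simp add: det_axis)
  qed
  ultimately have "\<not> negligible (extremal_simplex :: (real ^ 'n) set)" using negligible_subset by blast
  then have "interior (extremal_simplex :: (real ^ 'n) set) \<noteq> {}"
    using negligible_convex_interior[OF convex_extremal_simplex] by blast
  then show ?thesis
    unfolding convex_body_def by (intro conjI compact_extremal_simplex convex_extremal_simplex)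
qed

text \<open>The cones over the \<open>n + 1\<close> facets with apex 0 cover the simplex, and each has volume
  \<open>1 / n!\<close>.\<close>

lemma measure_extremal_simplex_le:
  "measure lebesgue (extremal_simplex :: (real ^ 'n) set) \<le> real (CARD('n) + 1) / fact CARD('n)"
proof -
  \<comment> \<open>\<open>Y k\<close> lists the vertices except \<open>axis k 1\<close>, with
    \<open>- 1\<close> in its slot.\<close>
  define Y where "Y k j = (if j = k then - 1 else axis j 1 :: real ^ 'n)" for k j :: 'n
  define T0 where "T0 = (convex hull (insert 0 (range (\<lambda>j. axis j 1))) :: (real ^ 'n) set)"
  define T where "T k = (convex hull (insert 0 (range (Y k))) :: (real ^ 'n) set)" for k
  have "det (\<chi> j. Y k j) = - 1" for k
  proof -
    have "(\<Sum>j\<in>UNIV. (- 1) *\<^sub>R axis j 1) = (- 1 :: real ^ 'n)"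
      using vec_eq_sum_axis[of "- 1 :: real ^ 'n"] by simp
    then show ?thesis
      using det_rows_replace[of k "\<lambda>_. - 1" "\<lambda>j. axis j 1 :: real ^ 'n"]
      by (simp only: Y_def det_axis mult_1_right)
  qed
  then have mT: "measure lebesgue (T k) = 1 / fact CARD('n)" for k
    using measure_convex_hull_0_range[of "Y k"] by (simp add: T_def)
  have mT0: "measure lebesgue T0 = 1 / fact CARD('n)"
    using measure_convex_hull_0_range[of "\<lambda>j. axis j 1 :: real ^ 'n"] by (simp add: T0_def det_axis)
  have comp: "compact T0" "compact (T k)" for k
    unfolding T0_def T_def by (intro finite_imp_compact_convex_hull; simp)+
  have sub: "extremal_simplex \<subseteq> T0 \<union> (\<Union>k. T k)"
  proof
    fix x :: "real ^ 'n" assume "x \<in> extremal_simplex"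
    then obtain u v b where uvb: "0 \<le> u" "0 \<le> v" "u + v = 1" "b \<in> convex hull (range (\<lambda>j. axis j 1))"
      "x = u *\<^sub>R (- 1) + v *\<^sub>R b" unfolding extremal_simplex_def by (auto simp: convex_hull_insert)
    define w where "w j = v * b $ j" for j
    have "convex hull (range (\<lambda>j. axis j 1)) \<subseteq> {b :: real ^ 'n. (\<forall>j. 0 \<le> b $ j) \<and> (\<Sum>j\<in>UNIV. b $ j) = 1}"
    proof (rule hull_minimal)
      show "convex {b :: real ^ 'n. (\<forall>j. 0 \<le> b $ j) \<and> (\<Sum>j\<in>UNIV. b $ j) = 1}"
        by (rule convexI) (simp add: sum.distrib sum_distrib_left[symmetric])
    qed (auto simp: axis_def)
    then have "\<And>j. 0 \<le> b $ j" "(\<Sum>j\<in>UNIV. b $ j) = 1" using uvb(4) by auto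
    then have w: "0 \<le> w j" "(\<Sum>j\<in>UNIV. w j) = 1 - u" for j
      using uvb by (simp_all add: w_def sum_distrib_left[symmetric])
    have x: "x $ j = w j - u" for j using uvb(5) by (simp add: w_def)
    show "x \<in> T0 \<union> (\<Union>k. T k)"
    \<comment> \<open>As the vertices sum to 0, a common amount may be subtracted from the weights
      \<open>u\<close> and \<open>w j\<close>. Subtracting the smallest one leaves a nonnegative
      combination that misses a vertex: \<open>- 1\<close> if \<open>u\<close> is smallest, some
      \<open>axis k 1\<close> otherwise.\<close>
    proof (cases "\<forall>j. u \<le> w j")
      case True
      have "(\<Sum>j\<in>UNIV. x $ j *\<^sub>R axis j 1) \<in> T0" unfolding T0_def
      proof (rule sub_convex_sum)
        show "(\<Sum>j\<in>UNIV. x $ j) \<le> 1"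
        proof -
          have "(\<Sum>j\<in>UNIV. x $ j) = 1 - u - real CARD('n) * u" using w(2) by (simp add: x sum_subtractf)
          moreover have "0 \<le> real CARD('n) * u" using uvb(1) by (intro mult_nonneg_nonneg) auto
          ultimately show ?thesis using uvb(1) by linarith
        qed
      qed (use True in \<open>auto simp: x intro: hull_inc\<close>)
      then show ?thesis using vec_eq_sum_axis[of x] by simp
    next
      case False
      have "Min (range w) \<in> range w" by (intro Min_in) auto
      then obtain k where "Min (range w) = w k" by (rule rangeE)
      then have k: "w k \<le> w j" for j using Min_le[of "range w" "w j"] by simp
      obtain j where "w j < u" using False by (auto simp: not_le)
      with k[of j] have wku: "w k < u" by simp
      \<comment> \<open>Slot \<open>k\<close> stands for the vertex \<open>- 1\<close> and carries
        its reduced weight \<open>u - w k\<close>.\<close>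
      define c where "c j = (if j = k then u - w k else w j - w k)" for j
      have "(\<Sum>j\<in>UNIV. c j *\<^sub>R Y k j) \<in> T k" unfolding T_def
      proof (rule sub_convex_sum)
        have "(\<Sum>j\<in>UNIV. c j) = (\<Sum>j\<in>UNIV. (w j - w k) + (if j = k then u - w k else 0))"
          by (rule sum.cong) (auto simp: c_def)
        also have "\<dots> = (1 - u - CARD('n) * w k) + (u - w k)" using w by (simp add: sum.distrib sum_subtractf)
        also have "\<dots> \<le> 1"
        proof -
          have "0 \<le> real CARD('n) * w k" using w(1) by (intro mult_nonneg_nonneg) auto
          then show ?thesis using w(1)[of k] by linarith
        qed
        finally show "(\<Sum>j\<in>UNIV. c j) \<le> 1" .
      qed (use k wku in \<open>auto simp: c_def intro: hull_inc\<close>)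
      moreover have "(\<Sum>j\<in>UNIV. c j *\<^sub>R Y k j) = x"
      proof -
        have "(\<Sum>j\<in>UNIV. c j *\<^sub>R Y k j) $ i = x $ i" for i
        proof -
          have "(\<Sum>j\<in>UNIV. c j *\<^sub>R Y k j) $ i = (\<Sum>j\<in>UNIV. (if j = i then w j - w k else 0) + (if j = k then w k - u else 0))"
            unfolding sum_component by (rule sum.cong) (auto simp: c_def Y_def axis_def)
          also have "\<dots> = w i - u" by (simp add: sum.distrib)
          finally show ?thesis by (simp add: x)
        qed
        then show ?thesis by (simp add: vec_eq_iff)
      qed
      ultimately show ?thesis by auto
    qed
  qed
  have lm: "T0 \<in> lmeasurable" "T k \<in> lmeasurable" "(\<Union>k. T k) \<in> lmeasurable" for k
    using comp by (auto intro: lmeasurable_compact intro!: fmeasurable.finite_UN)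
  have "measure lebesgue (extremal_simplex :: (real ^ 'n) set) \<le> measure lebesgue (T0 \<union> (\<Union>k. T k))"
    using sub lm lmeasurable_compact[OF compact_extremal_simplex]
    by (intro measure_mono_fmeasurable) (auto simp: fmeasurableD)
  also have "\<dots> \<le> measure lebesgue T0 + measure lebesgue (\<Union>k. T k)"
    using lm by (intro measure_Un_le) (auto simp: fmeasurableD)
  also have "\<dots> \<le> 1 / fact CARD('n) + (\<Sum>k\<in>(UNIV :: 'n set). 1 / fact CARD('n))"
    using measure_UNION_le[of UNIV T lebesgue] lm(2) by (simp add: mT mT0 fmeasurableD)
  also have "\<dots> = real (CARD('n) + 1) / fact CARD('n)" by (simp add: add_divide_distrib)
  finally show ?thesis .
qed

section \<open>Symmetries and the centroid of the extremal simplex\<close>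

text \<open>The determinant of an involution has square 1, and its preimages are its images, so
  boxes keep their volume.\<close>

lemma lborel_distr_linear_involution:
  fixes f :: "real ^ 'n \<Rightarrow> real ^ 'n"
  assumes f: "linear f" and inv: "\<And>x. f (f x) = x"
  shows "distr lborel borel f = lborel"
proof (rule lborel_eqI[symmetric])
  have [measurable]: "f \<in> borel_measurable borel"
    using f by (intro borel_measurable_continuous_onI linear_continuous_on linear_conv_bounded_linear[THEN iffD1])
  have "matrix f ** matrix f = mat 1"
    using matrix_compose[OF f f] inv by (simp add: o_def matrix_id_mat_1[symmetric] id_def)
  then have "det (matrix f) * det (matrix f) = 1" by (metis det_I det_mul)
  then have d: "\<bar>det (matrix f)\<bar> = 1" by (metis abs_1 abs_mult_self_eq abs_square_eq_1 power2_eq_square)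
  fix l u :: "real ^ 'n" assume lu: "\<And>b. b \<in> Basis \<Longrightarrow> l \<bullet> b \<le> u \<bullet> b"
  have eq: "f -` box l u = f ` box l u"
  proof (intro equalityI subsetI)
    fix x assume "x \<in> f -` box l u"
    then show "x \<in> f ` box l u" using inv[of x] by (intro image_eqI[of _ _ "f x"]) auto
  qed (use inv in auto)
  have bor: "f -` box l u \<in> sets borel" by (rule measurable_sets_borel[of _ borel]) auto
  have lm: "f ` box l u \<in> lmeasurable" by (intro lmeasurable_linear_image f lmeasurable_box)
  have "emeasure lborel (f -` box l u) = emeasure lebesgue (f ` box l u)"
    using bor by (simp add: eq)
  also have "\<dots> = ennreal (measure lebesgue (f ` box l u))" by (rule emeasure_eq_measure2[OF lm])
  also have "measure lebesgue (f ` box l u) = measure lebesgue (box l u)"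
    using measure_lebesgue_linear_image[OF f lmeasurable_box] d by simp
  also have "ennreal \<dots> = emeasure lebesgue (box l u)" by (rule emeasure_eq_measure2[OF lmeasurable_box, symmetric])
  also have "\<dots> = emeasure lborel (box l u)" by simp
  finally have "emeasure lborel (f -` box l u) = emeasure lborel (box l u)" .
  then show "emeasure (distr lborel borel f) (box l u) = (\<Prod>b\<in>Basis. (u - l) \<bullet> b)"
    using lu by (simp add: emeasure_distr)
qed simp

text \<open>Substituting \<open>f x\<close> for \<open>x\<close> changes neither Lebesgue measure
  nor \<open>K\<close>, and the linear map \<open>f\<close> commutes with the integral.\<close>

lemma integral_fixed_by_symmetry:
  fixes f :: "real ^ 'n \<Rightarrow> real ^ 'n"
  assumes f: "linear f" "\<And>x. f (f x) = x" and K: "compact K" "f ` K = K"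
  shows "f (LINT x:K|lebesgue. x) = (LINT x:K|lebesgue. x)"
proof -
  have [measurable]: "K \<in> sets borel" using K(1) by (rule borel_compact)
  have bl: "bounded_linear f" using f(1) by (rule linear_conv_bounded_linear[THEN iffD1])
  then have [measurable]: "f \<in> borel_measurable borel"
    by (intro borel_measurable_continuous_onI linear_continuous_on)
  have int: "integrable lborel (\<lambda>x. indicator K x *\<^sub>R x)"
    by (rule borel_integrable_compact[OF K(1)]) (rule continuous_on_id)
  have "f x \<in> K \<longleftrightarrow> x \<in> K" for x using K(2) f(2) by (metis imageE imageI)
  then have ind: "indicator K (f x) *\<^sub>R f x = f (indicator K x *\<^sub>R x)" for x
    by (simp add: linear_scale[OF f(1)] indicator_def)
  have "(LINT x|lborel. indicator K x *\<^sub>R x) = (LINT x|distr lborel borel f. indicator K x *\<^sub>R x)"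
    by (simp add: lborel_distr_linear_involution[OF f])
  also have "\<dots> = (LINT x|lborel. f (indicator K x *\<^sub>R x))"
    by (subst integral_distr) (simp_all add: ind)
  also have "\<dots> = f (LINT x|lborel. indicator K x *\<^sub>R x)"
    by (rule integral_bounded_linear[OF bl int])
  finally have "f (LINT x|lborel. indicator K x *\<^sub>R x) = (LINT x|lborel. indicator K x *\<^sub>R x)" by simp
  moreover have "(LINT x:K|lebesgue. x) = (LINT x|lborel. indicator K x *\<^sub>R x)"
    unfolding set_lebesgue_integral_def by (rule integral_completion) measurable
  ultimately show ?thesis by simp
qed

text \<open>Swapping the vertices \<open>-1\<close> and \<open>axis k 1\<close> is a linear involution whose fixed points have
  vanishing \<open>k\<close>-th coordinate.\<close>

lemma centroid_extremal_simplex: "centroid (extremal_simplex :: (real ^ 'n) set) = 0"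
proof -
  define c where "c = (LINT x:(extremal_simplex :: (real ^ 'n) set)|lebesgue. x)"
  have "c $ k = 0" for k
  proof -
    define f where "f x = x - x $ k *\<^sub>R (1 + axis k 1)" for x :: "real ^ 'n"
    have lin: "linear f" by (rule linearI) (simp_all add: f_def algebra_simps)
    have fk: "f x $ k = - x $ k" for x by (simp add: f_def)
    have inv: "f (f x) = x" for x
    proof -
      have "f (f x) = f x - f x $ k *\<^sub>R (1 + axis k 1)" by (rule f_def)
      then show ?thesis unfolding fk by (simp add: f_def)
    qed
    let ?V = "insert (- 1) (range (\<lambda>j. axis j 1)) :: (real ^ 'n) set"
    have f1: "f (- 1) = axis k 1" by (simp add: f_def)
    have f2: "f (axis j 1) = (if j = k then - 1 else axis j 1)" for j
      by (simp add: f_def) (simp add: axis_def)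
    have sub: "f x \<in> ?V" if "x \<in> ?V" for x
      using that
    proof (rule insertE)
      assume "x \<in> range (\<lambda>j. axis j 1)"
      then obtain j where "x = axis j 1" by (rule rangeE)
      then show ?thesis using f2[of j] by (cases "j = k") simp_all
    qed (simp add: f1)
    have V: "f ` ?V = ?V"
    proof (rule equalityI; rule subsetI)
      fix x assume "x \<in> ?V"
      then show "x \<in> f ` ?V" using sub[of x] inv[of x] by (metis imageI)
    qed (use sub in blast)
    have "f ` extremal_simplex = extremal_simplex"
      unfolding extremal_simplex_def convex_hull_linear_image[OF lin] V ..
    then have "f c = c"
      unfolding c_def by (intro integral_fixed_by_symmetry lin inv compact_extremal_simplex)
    then show ?thesis using fk[of c] by simp
  qed
  then have "c = 0" by (simp add: vec_eq_iff)
  then show ?thesis by (simp add: centroid_def c_def)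
qed

section \<open>Packing minima of the extremal simplex and sharpness\<close>

text \<open>Radius 1 is admissible because the simplex contains all unit vectors and a proper
  subspace misses one of them. For \<open>\<rho> < 1\<close> a coordinate subspace \<open>L\<close>
  is a counterexample: the simplex lies in the cube \<open>[-1, 1]^n\<close>, so an integer point of
  \<open>\<rho> K + L\<close> has coordinates of modulus below 1, hence 0, outside \<open>J\<close>,
  and lies in \<open>L\<close>.\<close>

lemma packing_minimum_extremal_simplex:
  assumes i: "1 \<le> i" "i \<le> CARD('n)"
  shows "packing_minimum i (extremal_simplex :: (real ^ 'n) set) int_lattice = 1"
proof -
  let ?K = "extremal_simplex :: (real ^ 'n) set"
  note 0 = zero_in_extremal_simplex[where 'n = 'n]
  have "1 \<in> packing_radii i ?K int_lattice"
  proof -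
    have "((*\<^sub>R) 1 ` ?K + L) \<inter> int_lattice \<noteq> L \<inter> int_lattice" if L: "L \<in> grassmannian (CARD('n) - i)" for L
    proof -
      have sub: "subspace L" and dim: "dim L < CARD('n)" using L i by (auto simp: grassmannian_def)
      have "\<exists>j. axis j 1 \<notin> L"
      proof (rule ccontr)
        assume "\<not> (\<exists>j. axis j 1 \<notin> L)"
        then have "span (range (\<lambda>j. axis j 1)) \<subseteq> L" using sub by (intro span_minimal) auto
        then have "L = UNIV" using det_rows_eq_0_iff[of "\<lambda>j. axis j 1 :: real ^ 'n"] by (auto simp: det_axis)
        then show False using dim by simp
      qed
      then obtain j where "axis j 1 \<notin> L" by blast
      then have "1 *\<^sub>R axis j 1 + 0 \<in> int_lattice - L" by (simp add: int_lattice_def axis_def)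
      then show ?thesis
        unfolding translates_meet_iff[OF 0] using extremal_simplex_vertices(2) subspace_0[OF sub] by blast
    qed
    then show ?thesis by (simp add: packing_radii_def)
  qed
  moreover have "1 \<le> \<rho>" if \<rho>: "\<rho> \<in> packing_radii i ?K int_lattice" for \<rho>
  proof (rule ccontr)
    assume "\<not> 1 \<le> \<rho>"
    then have r1: "0 < \<rho>" "\<rho> < 1" using \<rho> by (auto simp: packing_radii_def)
    obtain J :: "'n set" where J: "card J = CARD('n) - i"
      using obtain_subset_with_card_n[of "CARD('n) - i" "UNIV :: 'n set"] by auto
    define L where "L = {x :: real ^ 'n. \<forall>j. j \<notin> J \<longrightarrow> x $ j = 0}"
    have "subspace L" unfolding subspace_def L_def by auto
    moreover have "dim L = card J" unfolding L_def using dim_substandard_cart[where 'a = real, of J] by (simp add: dim_vec_eq)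
    ultimately have "L \<in> grassmannian (CARD('n) - i)" using J by (simp add: grassmannian_def)
    then have "((*\<^sub>R) \<rho> ` ?K + L) \<inter> int_lattice \<noteq> L \<inter> int_lattice" using \<rho> by (simp add: packing_radii_def)
    then obtain x l where xl: "x \<in> ?K" "l \<in> L" "\<rho> *\<^sub>R x + l \<in> int_lattice - L"
      unfolding translates_meet_iff[OF 0] by blast
    have "?K \<subseteq> cbox (- 1) 1"
      unfolding extremal_simplex_def
      by (intro hull_minimal) (auto simp: mem_box_cart axis_def)
    then have x1: "\<bar>x $ j\<bar> \<le> 1" for j using xl(1) by (force simp: mem_box_cart abs_le_iff)
    have "(\<rho> *\<^sub>R x + l) $ j = 0" if "j \<notin> J" for j
    proof -
      have "(\<rho> *\<^sub>R x + l) $ j = \<rho> * x $ j" using xl(2) that by (simp add: L_def)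
      moreover have "\<bar>\<rho> * x $ j\<bar> \<le> \<rho> * 1"
        unfolding abs_mult using r1 x1[of j] by (intro mult_mono) auto
      moreover have "(\<rho> *\<^sub>R x + l) $ j \<in> \<int>" using xl(3) by (simp add: int_lattice_def)
      ultimately show ?thesis using Ints_nonzero_abs_less1 r1 by force
    qed
    then have "\<rho> *\<^sub>R x + l \<in> L" by (simp add: L_def)
    then show False using xl(3) by blast
  qed
  ultimately show ?thesis unfolding packing_minimum_eq_Inf by (rule cInf_eq_minimum)
qed

theorem theorem1p1:
  shows "(\<forall>(K :: (real ^ 'n) set) \<Lambda>.
            convex_body K \<and> centroid K = 0 \<and> full_lattice \<Lambda> \<longrightarrow>
            real (CARD('n) + 1) / fact CARD('n) * (\<Prod>i = 1..CARD('n). 1 / packing_minimum i K \<Lambda>)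
              \<le> measure lebesgue K / lattice_det \<Lambda>) \<and>
         (\<forall>c :: real.
            (\<forall>(K :: (real ^ 'n) set) \<Lambda>.
               convex_body K \<and> centroid K = 0 \<and> full_lattice \<Lambda> \<longrightarrow>
               c * (\<Prod>i = 1..CARD('n). 1 / packing_minimum i K \<Lambda>)
                 \<le> measure lebesgue K / lattice_det \<Lambda>) \<longrightarrow>
            c \<le> real (CARD('n) + 1) / fact CARD('n))"
proof (intro conjI allI impI)
  fix K \<Lambda> :: "(real ^ 'n) set"
  assume "convex_body K \<and> centroid K = 0 \<and> full_lattice \<Lambda>"
  then show "real (CARD('n) + 1) / fact CARD('n) * (\<Prod>i = 1..CARD('n). 1 / packing_minimum i K \<Lambda>)
      \<le> measure lebesgue K / lattice_det \<Lambda>"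
    by (intro packing_minima_volume_bound) auto
next
  fix c :: real
  let ?K = "extremal_simplex :: (real ^ 'n) set" and ?Z = "int_lattice :: (real ^ 'n) set"
  assume "\<forall>(K :: (real ^ 'n) set) \<Lambda>. convex_body K \<and> centroid K = 0 \<and> full_lattice \<Lambda> \<longrightarrow>
      c * (\<Prod>i = 1..CARD('n). 1 / packing_minimum i K \<Lambda>) \<le> measure lebesgue K / lattice_det \<Lambda>"
  \<comment> \<open>The constant \<open>c\<close> is tested on the extremal simplex and the integer
    lattice.\<close>
  then have "c * (\<Prod>i = 1..CARD('n). 1 / packing_minimum i ?K ?Z) \<le> measure lebesgue ?K / lattice_det ?Z"
    using convex_body_extremal_simplex centroid_extremal_simplex full_lattice_int_lattice by blast
  moreover have "(\<Prod>i = 1..CARD('n). 1 / packing_minimum i ?K ?Z) = 1"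
    by (intro prod.neutral) (simp add: packing_minimum_extremal_simplex)
  ultimately have "c \<le> measure lebesgue ?K / lattice_det ?Z" by simp
  also have "\<dots> \<le> measure lebesgue ?K / 1"
    using one_le_lattice_det_int_lattice[where 'n = 'n] by (intro divide_left_mono) auto
  also have "\<dots> \<le> real (CARD('n) + 1) / fact CARD('n)" using measure_extremal_simplex_le[where 'n = 'n] by simp
  finally show "c \<le> real (CARD('n) + 1) / fact CARD('n)" .
qed

end
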